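(* Let $p\in(1,\infty)$ and let $W_p=\bigl(\bigoplus_{n\in\mathbb{N}}\ell_\infty^n\bigr)_{\ell_p}$, with dual Banach space $W_p^*$. Then the set $\mathscr{M}_{W_p}$ is the unique maximal ideal of the Banach algebra $\mathscr{B}(W_p)$, and the set $\mathscr{M}_{W_p^*}$ is the unique maximal ideal of the Banach algebra $\mathscr{B}(W_p^* )$.
   Context: All Banach spaces are over the same scalar field $\mathbb{K}$, either $\mathbb{R}$ or $\mathbb{C}$. An operator is a bounded, linear mapping between Banach spaces, and $\mathscr{B}(X)$ is the Banach algebra of all operators on the Banach space $X$. Here $\ell_\infty^n$ is $\mathbb{K}^n$ with the maximum norm, and $\bigl(\bigoplus_{n\in\mathbb{N}}X_n\bigr)_{\ell_p}$ is the Banach space of sequences $(x_n)_{n\in\mathbb{N}}$ with $x_n\in X_n$ and $\sum_{n=1}^\infty\|x_n\|^p<\infty$, with norm $\bigl(\sum_{n=1}^\infty\|x_n\|^p\bigr)^{1/p}$. For a Banach space $X$, set $\mathscr{M}_X=\{T\in\mathscr{B}(X): \text{the identity operator on } X \text{ does not factor through } T\}$; the identity operator $I_X$ factors through $T$ if $I_X=STR$ for some $R,S\in\mathscr{B}(X)$. An ideal means a two-sided, algebraic ideal (not assumed closed), and a maximal ideal is a proper ideal which is maximal with respect to inclusion among proper ideals. *)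

theory Defs
  imports Complex_Main "HOL-Library.Function_Algebras" "HOL-Algebra.Ideal"
begin

text \<open>
  The exponent \<open>p\<close> is a variable of the theorem, so the spaces cannot be types.  A normed space
  over \<open>'k\<close> is a set of vectors in an ambient abelian group \<open>'v\<close>, together with a scalar
  multiplication and a norm that are only meaningful on that set.  Addition and zero are those of
  \<open>'v\<close>; every \<open>'v\<close> used below is a function type with pointwise addition.  The scalar field is
  meant to be \<open>real\<close> or \<open>complex\<close>, and \<open>W_space\<close> takes it as a type argument.
\<close>

record ('k, 'v) normed_space = "'v partial_object" +
  scl :: "'k \<Rightarrow> 'v \<Rightarrow> 'v"
  nrm :: "'v \<Rightarrow> real"

definition scalar_space :: "('k::real_normed_field, 'k) normed_space" where
  "scalar_space = \<lparr>carrier = UNIV, scl = (*), nrm = norm\<rparr>"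

text \<open>The space \<open>\<ell>\<^sub>\<infinity>\<^sup>n\<close>, with coordinates indexed by \<open>i < n\<close>; used for \<open>n \<ge> 1\<close> only.\<close>

definition linf :: "nat \<Rightarrow> ('k::real_normed_field, nat \<Rightarrow> 'k) normed_space" where
  "linf n = \<lparr>carrier = {v. \<forall>i\<ge>n. v i = 0},
             scl = (\<lambda>c v i. c * v i),
             nrm = (\<lambda>v. Max ((\<lambda>i. norm (v i)) ` {..<n}))\<rparr>"

definition lp_sum ::
  "real \<Rightarrow> (nat \<Rightarrow> ('k, 'v) normed_space) \<Rightarrow> ('k, nat \<Rightarrow> 'v) normed_space" where
  "lp_sum p X =
     \<lparr>carrier = {x. (\<forall>n. x n \<in> carrier (X n)) \<and> summable (\<lambda>n. nrm (X n) (x n) powr p)},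
      scl = (\<lambda>c x n. scl (X n) c (x n)),
      nrm = (\<lambda>x. (\<Sum>n. nrm (X n) (x n) powr p) powr (1 / p))\<rparr>"

text \<open>The summands are \<open>\<ell>\<^sub>\<infinity>\<^sup>1, \<ell>\<^sub>\<infinity>\<^sup>2, \<dots>\<close>; since \<open>nat\<close> starts at 0, the index is shifted.\<close>

definition W_space ::
  "'k itself \<Rightarrow> real \<Rightarrow> ('k::real_normed_field, nat \<Rightarrow> nat \<Rightarrow> 'k) normed_space" where
  "W_space K p = lp_sum p (\<lambda>n. linf (Suc n))"

text \<open>
  Bounded linear operators from \<open>X\<close> to \<open>Y\<close>.  They are made zero outside the carrier of \<open>X\<close>, so
  that an operator is determined by its values on \<open>X\<close> and equality of operators is equality of
  functions.  This convention is preserved by composition and pointwise sums.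
\<close>

definition operators ::
  "('k, 'v::ab_group_add) normed_space \<Rightarrow> ('k, 'w::ab_group_add) normed_space \<Rightarrow> ('v \<Rightarrow> 'w) set"
  where
  "operators X Y =
     {T. (\<forall>x\<in>carrier X. T x \<in> carrier Y) \<and>
         (\<forall>x\<in>carrier X. \<forall>y\<in>carrier X. T (x + y) = T x + T y) \<and>
         (\<forall>c. \<forall>x\<in>carrier X. T (scl X c x) = scl Y c (T x)) \<and>
         (\<exists>C. \<forall>x\<in>carrier X. nrm Y (T x) \<le> C * nrm X x) \<and>
         (\<forall>x. x \<notin> carrier X \<longrightarrow> T x = 0)}"

definition operator_norm ::
  "('k, 'v) normed_space \<Rightarrow> ('k, 'w) normed_space \<Rightarrow> ('v \<Rightarrow> 'w) \<Rightarrow> real" where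
  "operator_norm X Y T = (SUP x\<in>{x \<in> carrier X. nrm X x \<le> 1}. nrm Y (T x))"

definition dual_space ::
  "('k::real_normed_field, 'v::ab_group_add) normed_space \<Rightarrow> ('k, 'v \<Rightarrow> 'k) normed_space" where
  "dual_space X =
     \<lparr>carrier = operators X scalar_space,
      scl = (\<lambda>c f x. c * f x),
      nrm = operator_norm X scalar_space\<rparr>"

definition identity_operator :: "('k, 'v::zero) normed_space \<Rightarrow> 'v \<Rightarrow> 'v" where
  "identity_operator X = (\<lambda>x. if x \<in> carrier X then x else 0)"

text \<open>
  The algebra of operators on \<open>X\<close>, as a ring.  As it is unital, its ring ideals are the same as
  its algebra ideals: \<open>c T\<close> is the product of \<open>c I\<close> and \<open>T\<close>.
\<close>

definition operator_algebra :: "('k, 'v::ab_group_add) normed_space \<Rightarrow> ('v \<Rightarrow> 'v) ring" where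
  "operator_algebra X =
     \<lparr>carrier = operators X X, mult = (\<circ>), one = identity_operator X, zero = 0, add = (+)\<rparr>"

definition identity_factors_through ::
  "('k, 'v::ab_group_add) normed_space \<Rightarrow> ('v \<Rightarrow> 'v) \<Rightarrow> bool" where
  "identity_factors_through X T \<longleftrightarrow>
     (\<exists>R\<in>operators X X. \<exists>S\<in>operators X X. identity_operator X = S \<circ> T \<circ> R)"

definition M_set :: "('k, 'v::ab_group_add) normed_space \<Rightarrow> ('v \<Rightarrow> 'v) set" where
  "M_set X = {T \<in> operators X X. \<not> identity_factors_through X T}"

definition unique_maximal_ideal :: "'a set \<Rightarrow> ('a, 'm) ring_scheme \<Rightarrow> bool" where
  "unique_maximal_ideal M R \<longleftrightarrow> maximalideal M R \<and> (\<forall>J. maximalideal J R \<longrightarrow> J = M)"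

end

theory Submission
  imports Defs "HOL-Analysis.Convex"
begin

text \<open>
  Write \<open>Y\<close> for \<open>W\<^sub>p\<close> or its dual.  The set \<open>M\<^sub>Y\<close> absorbs products and contains every proper
  ideal, so everything rests on its closure under addition, and this follows from a dichotomy: for
  every operator \<open>T\<close> on \<open>Y\<close>, the identity factors through \<open>T\<close> or through \<open>I - T\<close>
  (\<open>unique_maximal_ideal_M_set\<close>).
  
  For the dichotomy, view \<open>T\<close> as a scalar matrix over the coordinates \<open>(n, i)\<close>, \<open>i \<le> n\<close>, where \<open>n\<close>
  numbers the blocks.  Three facts about this matrix suffice.  Its columns tend to zero, because finitely
  supported vectors are dense.  Its rows tend to zero, because the unit vectors are weakly null; this is
  where \<open>1 < p < \<infinity>\<close> enters, for the space and for its dual.  Finally, inside one diagonal block all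
  rows (for \<open>W\<^sub>p\<close>, whose blocks carry a maximum norm) or all columns (for the dual, whose blocks
  carry a sum norm) have absolute sum at most \<open>\<parallel>T\<parallel>\<close>, so each contains a bounded number of
  entries above a given threshold.  Each diagonal entry of \<open>T\<close> or the corresponding one of \<open>I - T\<close>
  has modulus at least \<open>1/2\<close>, so one of the two has many large diagonal entries in arbitrarily large
  blocks.  A graph argument finds among them \<open>n + 1\<close> coordinates with negligible mutual entries, and
  going far out makes the entries between the chosen blocks negligible
  (\<open>select_nearly_diagonal\<close>).
  
  The coordinates so chosen span a copy of \<open>Y\<close>, onto which \<open>Y\<close> projects.  The compression of
  \<open>T\<close> (or of \<open>I - T\<close>) to it, divided by its diagonal, differs from the identity by an operator of norm at most
  \<open>1/2\<close>, since the sum of all moduli of the remaining matrix entries is that small.  It is therefore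
  invertible, which factors the identity
  (\<open>identity_factors_through_of_nearly_diagonal\<close>, \<open>identity_factors_dichotomy\<close>).
  
  The argument uses only an axiomatic interface, \<open>sparse_block_basis\<close>.  A stronger interface,
  \<open>strict_block_basis\<close>, implies it for a space and, by taking adjoints, for its dual
  (\<open>strict_block_basis.sparse\<close>, \<open>sparse_block_basis_dual\<close>); \<open>W\<^sub>p\<close> satisfies the
  stronger one (\<open>strict_block_basis_W\<close>).  Weak nullity is a short extremality argument
  (\<open>functional_small_on_tails\<close>): two disjointly supported unit vectors have a sum of norm at most
  \<open>\<theta> < 2\<close>, so a functional cannot be almost extremal on two successive tails.
\<close>

section \<open>Normed spaces on a carrier and their operators\<close>

locale normed_vspace =
  fixes Y :: "('k::real_normed_field, 'v::ab_group_add) normed_space"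
  assumes zero_mem: "0 \<in> carrier Y"
    and add_mem: "\<lbrakk>x \<in> carrier Y; y \<in> carrier Y\<rbrakk> \<Longrightarrow> x + y \<in> carrier Y"
    and scl_mem: "x \<in> carrier Y \<Longrightarrow> scl Y c x \<in> carrier Y"
    and scl_add_right: "\<lbrakk>x \<in> carrier Y; y \<in> carrier Y\<rbrakk> \<Longrightarrow> scl Y c (x + y) = scl Y c x + scl Y c y"
    and scl_add_left: "x \<in> carrier Y \<Longrightarrow> scl Y (a + b) x = scl Y a x + scl Y b x"
    and scl_scl: "x \<in> carrier Y \<Longrightarrow> scl Y a (scl Y b x) = scl Y (a * b) x"
    and scl_one: "x \<in> carrier Y \<Longrightarrow> scl Y 1 x = x"
    and nrm_triangle: "\<lbrakk>x \<in> carrier Y; y \<in> carrier Y\<rbrakk> \<Longrightarrow> nrm Y (x + y) \<le> nrm Y x + nrm Y y"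
    and nrm_scl: "x \<in> carrier Y \<Longrightarrow> nrm Y (scl Y c x) = norm c * nrm Y x"
    and nrm_eq_0: "\<lbrakk>x \<in> carrier Y; nrm Y x = 0\<rbrakk> \<Longrightarrow> x = 0"

lemma normed_vspace_scalar: "normed_vspace (scalar_space :: ('k::real_normed_field, 'k) normed_space)"
  by unfold_locales
    (auto simp: scalar_space_def algebra_simps norm_mult intro: norm_triangle_ineq)

lemma scalar_space_simps [simp]:
  "carrier scalar_space = UNIV" "scl scalar_space = (*)" "nrm scalar_space = norm"
  by (simp_all add: scalar_space_def)

lemma operatorsI:
  assumes "\<And>x. x \<in> carrier X \<Longrightarrow> T x \<in> carrier Z"
    and "\<And>x y. \<lbrakk>x \<in> carrier X; y \<in> carrier X\<rbrakk> \<Longrightarrow> T (x + y) = T x + T y"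
    and "\<And>c x. x \<in> carrier X \<Longrightarrow> T (scl X c x) = scl Z c (T x)"
    and "\<And>x. x \<in> carrier X \<Longrightarrow> nrm Z (T x) \<le> C * nrm X x"
    and "\<And>x. x \<notin> carrier X \<Longrightarrow> T x = 0"
  shows "T \<in> operators X Z"
  using assms unfolding operators_def by blast

lemma
  assumes "T \<in> operators X Z"
  shows op_mem: "x \<in> carrier X \<Longrightarrow> T x \<in> carrier Z"
    and op_add: "\<lbrakk>x \<in> carrier X; y \<in> carrier X\<rbrakk> \<Longrightarrow> T (x + y) = T x + T y"
    and op_scl: "x \<in> carrier X \<Longrightarrow> T (scl X c x) = scl Z c (T x)"
    and op_outside: "x \<notin> carrier X \<Longrightarrow> T x = 0"
  using assms by (simp_all add: operators_def)

lemma op_bounded: "T \<in> operators X Z \<Longrightarrow> \<exists>C. \<forall>x\<in>carrier X. nrm Z (T x) \<le> C * nrm X x"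
  by (simp add: operators_def)

context normed_vspace
begin

lemma scl_zero_left: "x \<in> carrier Y \<Longrightarrow> scl Y 0 x = 0"
  using scl_add_left[of x 0 0] by simp

lemma scl_minus_one: "x \<in> carrier Y \<Longrightarrow> scl Y (-1) x = - x"
  using scl_add_left[of x 1 "-1"] by (simp add: scl_zero_left scl_one eq_neg_iff_add_eq_0 add.commute)

lemma minus_mem: "x \<in> carrier Y \<Longrightarrow> - x \<in> carrier Y"
  using scl_mem[of x "-1"] by (simp add: scl_minus_one)

lemma diff_mem: "\<lbrakk>x \<in> carrier Y; y \<in> carrier Y\<rbrakk> \<Longrightarrow> x - y \<in> carrier Y"
  using add_mem[of x "- y"] minus_mem[of y] by simp

lemma sum_mem: "(\<And>a. a \<in> A \<Longrightarrow> f a \<in> carrier Y) \<Longrightarrow> sum f A \<in> carrier Y"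
  by (induction A rule: infinite_finite_induct) (auto simp: zero_mem add_mem)

lemma scl_zero_right: "scl Y c 0 = 0"
  using scl_add_right[OF zero_mem zero_mem, of c] by simp

lemma nrm_zero: "nrm Y 0 = 0"
  using nrm_scl[OF zero_mem, of 0] by (simp add: scl_zero_right)

lemma nrm_minus: "x \<in> carrier Y \<Longrightarrow> nrm Y (- x) = nrm Y x"
  using nrm_scl[of x "-1"] by (simp add: scl_minus_one)

lemma nrm_nonneg: "x \<in> carrier Y \<Longrightarrow> 0 \<le> nrm Y x"
  using nrm_triangle[of x "- x"] by (simp add: minus_mem nrm_minus nrm_zero)

lemma nrm_minus_commute: "\<lbrakk>x \<in> carrier Y; y \<in> carrier Y\<rbrakk> \<Longrightarrow> nrm Y (x - y) = nrm Y (y - x)"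
  using nrm_minus[OF diff_mem[of x y]] by simp

lemma nrm_diff_triangle:
  "\<lbrakk>x \<in> carrier Y; y \<in> carrier Y; z \<in> carrier Y\<rbrakk> \<Longrightarrow> nrm Y (x - z) \<le> nrm Y (x - y) + nrm Y (y - z)"
  using nrm_triangle[of "x - y" "y - z"] by (simp add: diff_mem)

lemma nrm_triangle_sub: "\<lbrakk>x \<in> carrier Y; y \<in> carrier Y\<rbrakk> \<Longrightarrow> nrm Y x \<le> nrm Y y + nrm Y (x - y)"
  using nrm_triangle[of y "x - y"] by (simp add: diff_mem)

lemma nrm_sum: "(\<And>a. a \<in> A \<Longrightarrow> f a \<in> carrier Y) \<Longrightarrow> nrm Y (sum f A) \<le> (\<Sum>a\<in>A. nrm Y (f a))"
proof (induction A rule: infinite_finite_induct)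
  case (insert a A)
  then show ?case
    using nrm_triangle[of "f a" "sum f A"] by (force simp: sum_mem)
qed (auto simp: nrm_zero)

lemma scl_sum:
  "(\<And>a. a \<in> A \<Longrightarrow> f a \<in> carrier Y) \<Longrightarrow> scl Y c (sum f A) = (\<Sum>a\<in>A. scl Y c (f a))"
  by (induction A rule: infinite_finite_induct) (auto simp: scl_zero_right scl_add_right sum_mem)

lemma op_zero: "T \<in> operators Y Z \<Longrightarrow> T 0 = 0"
  using op_add[of T Y Z 0 0] by (simp add: zero_mem)

lemma op_minus: "\<lbrakk>T \<in> operators Y Z; x \<in> carrier Y\<rbrakk> \<Longrightarrow> T (- x) = - T x"
  using op_add[of T Y Z x "- x"] by (simp add: minus_mem op_zero eq_neg_iff_add_eq_0 add.commute)

lemma op_diff: "\<lbrakk>T \<in> operators Y Z; x \<in> carrier Y; y \<in> carrier Y\<rbrakk> \<Longrightarrow> T (x - y) = T x - T y"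
  using op_add[of T Y Z x "- y"] by (simp add: minus_mem op_minus)

lemma op_sum:
  assumes "T \<in> operators Y Z" and "\<And>a. a \<in> A \<Longrightarrow> f a \<in> carrier Y"
  shows "T (sum f A) = (\<Sum>a\<in>A. T (f a))"
  using assms(2)
proof (induction A rule: infinite_finite_induct)
  case (insert a A)
  then show ?case
    by (simp add: op_add[OF assms(1)] sum_mem)
qed (auto simp: op_zero[OF assms(1)])

lemma op_bound:
  assumes "T \<in> operators Y Z"
  obtains C where "0 \<le> C" "\<And>x. x \<in> carrier Y \<Longrightarrow> nrm Z (T x) \<le> C * nrm Y x"
proof -
  obtain C where C: "\<And>x. x \<in> carrier Y \<Longrightarrow> nrm Z (T x) \<le> C * nrm Y x"
    using op_bounded[OF assms] by blast
  show thesis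
  proof (rule that[of "max C 0"])
    fix x assume x: "x \<in> carrier Y"
    have "C * nrm Y x \<le> max C 0 * nrm Y x"
      by (rule mult_right_mono) (auto simp: nrm_nonneg x)
    then show "nrm Z (T x) \<le> max C 0 * nrm Y x"
      using C[OF x] by linarith
  qed simp
qed

lemma zero_operator: "0 \<in> operators X Y"
  by (rule operatorsI[where C = 0]) (auto simp: zero_mem scl_zero_right nrm_zero)

lemma operators_add:
  assumes S: "S \<in> operators X Y" and T: "T \<in> operators X Y"
  shows "S + T \<in> operators X Y"
proof -
  obtain C D where C: "\<And>x. x \<in> carrier X \<Longrightarrow> nrm Y (S x) \<le> C * nrm X x"
    and D: "\<And>x. x \<in> carrier X \<Longrightarrow> nrm Y (T x) \<le> D * nrm X x"
    using op_bounded[OF S] op_bounded[OF T] by blast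
  show ?thesis
  proof (rule operatorsI[where C = "C + D"])
    fix x assume x: "x \<in> carrier X"
    have "nrm Y (S x + T x) \<le> nrm Y (S x) + nrm Y (T x)"
      by (intro nrm_triangle op_mem[OF S] op_mem[OF T] x)
    then show "nrm Y ((S + T) x) \<le> (C + D) * nrm X x"
      using C[OF x] D[OF x] by (simp add: algebra_simps)
  qed (auto simp: op_mem[OF S] op_mem[OF T] add_mem op_add[OF S] op_add[OF T] op_scl[OF S]
      op_scl[OF T] scl_add_right op_outside[OF S] op_outside[OF T])
qed

lemma operators_scl:
  assumes S: "S \<in> operators X Y"
  shows "(\<lambda>x. scl Y c (S x)) \<in> operators X Y"
proof -
  obtain C where C: "\<And>x. x \<in> carrier X \<Longrightarrow> nrm Y (S x) \<le> C * nrm X x"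
    using op_bounded[OF S] by blast
  show ?thesis
  proof (rule operatorsI[where C = "norm c * C"])
    fix x assume x: "x \<in> carrier X"
    show "nrm Y (scl Y c (S x)) \<le> norm c * C * nrm X x"
      using mult_left_mono[OF C[OF x], of "norm c"] by (simp add: nrm_scl op_mem[OF S x] mult.assoc)
  qed (simp_all add: op_mem[OF S] scl_mem op_add[OF S] scl_add_right op_scl[OF S] scl_scl
      op_outside[OF S] scl_zero_right mult.commute)
qed

lemma operators_minus:
  assumes "S \<in> operators X Y"
  shows "- S \<in> operators X Y"
proof -
  have "- S = (\<lambda>x. scl Y (-1) (S x))"
  proof
    fix x
    show "(- S) x = scl Y (-1) (S x)"
      by (cases "x \<in> carrier X")
        (auto simp: fun_Compl_def scl_minus_one op_mem[OF assms] op_outside[OF assms] scl_zero_right)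
  qed
  then show ?thesis
    using operators_scl[OF assms] by metis
qed

lemma operators_diff:
  assumes "S \<in> operators X Y" "T \<in> operators X Y"
  shows "S - T \<in> operators X Y"
  using operators_add[OF assms(1) operators_minus[OF assms(2)]] by simp

lemma operators_comp:
  assumes S: "S \<in> operators Y Z" and T: "T \<in> operators X Y"
  shows "S \<circ> T \<in> operators X Z"
proof -
  obtain C where C: "0 \<le> C" "\<And>x. x \<in> carrier Y \<Longrightarrow> nrm Z (S x) \<le> C * nrm Y x"
    using op_bound[OF S] by blast
  obtain D where D: "\<And>x. x \<in> carrier X \<Longrightarrow> nrm Y (T x) \<le> D * nrm X x"
    using op_bounded[OF T] by blast
  show ?thesis
  proof (rule operatorsI[where C = "C * D"])
    fix x assume x: "x \<in> carrier X"
    have "nrm Z (S (T x)) \<le> C * nrm Y (T x)"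
      by (intro C op_mem[OF T] x)
    also have "\<dots> \<le> C * (D * nrm X x)"
      by (intro mult_left_mono D x C)
    finally show "nrm Z ((S \<circ> T) x) \<le> C * D * nrm X x"
      by (simp add: mult.assoc)
  qed (auto simp: op_mem[OF T] op_mem[OF S] op_add[OF T] op_add[OF S] op_scl[OF T] op_scl[OF S]
      op_outside[OF T] op_zero[OF S])
qed

lemma identity_operator_mem: "identity_operator Y \<in> operators Y Y"
  by (rule operatorsI[where C = 1]) (auto simp: identity_operator_def add_mem scl_mem)

lemma comp_identity: "T \<in> operators Y Z \<Longrightarrow> T \<circ> identity_operator Y = T"
  by (auto simp: identity_operator_def fun_eq_iff op_zero op_outside)

lemma identity_comp: "T \<in> operators X Y \<Longrightarrow> identity_operator Y \<circ> T = T"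
  by (auto simp: identity_operator_def fun_eq_iff)
    (metis op_mem op_outside)

lemma comp_add:
  assumes R: "R \<in> operators Y Z" and S: "S \<in> operators X Y" and T: "T \<in> operators X Y"
  shows "R \<circ> (S + T) = (R \<circ> S) + (R \<circ> T)"
proof
  fix x
  show "(R \<circ> (S + T)) x = ((R \<circ> S) + (R \<circ> T)) x"
    by (cases "x \<in> carrier X")
      (auto simp: op_add[OF R] op_mem[OF S] op_mem[OF T] op_outside[OF S] op_outside[OF T] op_zero[OF R])
qed

section \<open>A criterion for a unique maximal ideal\<close>

lemma ring_operator_algebra: "ring (operator_algebra Y)"
proof (rule ringI)
  show "abelian_group (operator_algebra Y)"
  proof (rule abelian_groupI)
    fix T assume "T \<in> carrier (operator_algebra Y)"
    then show "\<exists>S\<in>carrier (operator_algebra Y). S \<oplus>\<^bsub>operator_algebra Y\<^esub> T = \<zero>\<^bsub>operator_algebra Y\<^esub>"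
      by (intro bexI[of _ "- T"]) (auto simp: operator_algebra_def operators_minus)
  qed (auto simp: operator_algebra_def zero_operator operators_add add_ac)
  show "monoid (operator_algebra Y)"
    by (rule monoidI)
      (auto simp: operator_algebra_def operators_comp identity_operator_mem comp_identity
        identity_comp comp_assoc)
qed (auto simp: operator_algebra_def comp_add fun_eq_iff)

lemma identity_factors_through_of_comp:
  assumes R: "R \<in> operators Y Y" and S: "S \<in> operators Y Y"
    and f: "identity_factors_through Y (S \<circ> T \<circ> R)"
  shows "identity_factors_through Y T"
proof -
  obtain R' S' where R': "R' \<in> operators Y Y" and S': "S' \<in> operators Y Y"
    and eq: "identity_operator Y = S' \<circ> (S \<circ> T \<circ> R) \<circ> R'"
    using f by (auto simp: identity_factors_through_def)
  then have "identity_operator Y = (S' \<circ> S) \<circ> T \<circ> (R \<circ> R')"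
    by (simp add: comp_assoc)
  then show ?thesis
    unfolding identity_factors_through_def
    using operators_comp[OF R R'] operators_comp[OF S' S] by blast
qed

text \<open>
  If \<open>I = V (S + T) U\<close>, then \<open>I - V S U = V T U\<close>, and the dichotomy applied to \<open>V S U\<close> shows that
  \<open>I\<close> factors through \<open>S\<close> or through \<open>T\<close>; hence the set is closed under sums.  A proper ideal cannot
  contain an operator through which \<open>I\<close> factors, so the set contains every proper ideal.
\<close>
lemma unique_maximal_ideal_M_set:
  assumes nontrivial: "\<exists>x\<in>carrier Y. x \<noteq> 0"
    and dichotomy: "\<And>T. T \<in> operators Y Y \<Longrightarrow>
      identity_factors_through Y T \<or> identity_factors_through Y (identity_operator Y - T)"
  shows "unique_maximal_ideal (M_set Y) (operator_algebra Y)"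
proof -
  let ?A = "operator_algebra Y" and ?I = "identity_operator Y"
  interpret A: ring ?A by (rule ring_operator_algebra)
  have I: "identity_factors_through Y ?I"
    unfolding identity_factors_through_def
    by (intro bexI[of _ ?I]) (simp_all add: identity_operator_mem comp_identity[OF identity_operator_mem])
  have sum: "identity_factors_through Y S \<or> identity_factors_through Y T"
    if S: "S \<in> operators Y Y" and T: "T \<in> operators Y Y" and f: "identity_factors_through Y (S + T)" for S T
  proof -
    obtain U V where U: "U \<in> operators Y Y" and V: "V \<in> operators Y Y"
      and eq: "?I = V \<circ> (S + T) \<circ> U"
      using f by (auto simp: identity_factors_through_def)
    have "V \<circ> (S + T) \<circ> U = (V \<circ> S \<circ> U) + (V \<circ> T \<circ> U)"
      by (simp only: comp_add[OF V S T]) (simp add: fun_eq_iff)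
    then have "?I - (V \<circ> S \<circ> U) = V \<circ> T \<circ> U"
      by (simp add: eq)
    moreover have "V \<circ> S \<circ> U \<in> operators Y Y"
      by (intro operators_comp U V S)
    ultimately show ?thesis
      using dichotomy[of "V \<circ> S \<circ> U"] identity_factors_through_of_comp[OF U V] by metis
  qed
  have ideal: "ideal (M_set Y) ?A"
  proof (rule idealI)
    show "ring ?A" by (rule ring_operator_algebra)
    have minus_closed: "- T \<in> M_set Y" if T: "T \<in> M_set Y" for T
    proof -
      have T': "T \<in> operators Y Y" using T by (simp add: M_set_def)
      (* -T is obtained from T by composing with operators, so factoring through -T is
         factoring through T. *)
      have eq: "?I \<circ> T \<circ> (- ?I) = - T"
      proof
        fix x show "(?I \<circ> T \<circ> (- ?I)) x = (- T) x"
          by (cases "x \<in> carrier Y")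
            (simp_all add: identity_operator_def fun_Compl_def op_minus[OF T'] op_mem[OF T'] minus_mem
              op_outside[OF T'] op_zero[OF T'])
      qed
      have "identity_factors_through Y T" if "identity_factors_through Y (- T)"
        by (rule identity_factors_through_of_comp[OF operators_minus[OF identity_operator_mem]
              identity_operator_mem]) (simp only: eq that)
      then show ?thesis
        using T by (auto simp: M_set_def operators_minus)
    qed
    show "subgroup (M_set Y) (add_monoid ?A)"
    proof (rule A.add.subgroupI)
      show "M_set Y \<subseteq> carrier ?A"
        by (auto simp: M_set_def operator_algebra_def)
      have "\<not> identity_factors_through Y 0"
      proof
        assume "identity_factors_through Y 0"
        then obtain U V where U: "U \<in> operators Y Y" and V: "V \<in> operators Y Y"
          and "?I = V \<circ> 0 \<circ> U"
          by (auto simp: identity_factors_through_def)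
        then have zero: "?I x = 0" for x
          by (simp add: op_zero[OF V])
        obtain x where "x \<in> carrier Y" "x \<noteq> 0"
          using nontrivial by blast
        then show False
          using zero[of x] by (simp add: identity_operator_def)
      qed
      then show "M_set Y \<noteq> {}"
        using zero_operator by (auto simp: M_set_def)
      fix T assume T: "T \<in> M_set Y"
      have "\<ominus>\<^bsub>?A\<^esub> T = - T"
        by (rule A.minus_equality)
          (use T in \<open>auto simp: operator_algebra_def M_set_def operators_minus\<close>)
      then show "\<ominus>\<^bsub>?A\<^esub> T \<in> M_set Y"
        using minus_closed[OF T] by simp
    next
      fix S T assume "S \<in> M_set Y" "T \<in> M_set Y"
      then show "S \<oplus>\<^bsub>?A\<^esub> T \<in> M_set Y"
        using sum by (auto simp: M_set_def operator_algebra_def operators_add)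
    qed
    fix S T assume S: "S \<in> M_set Y" and T: "T \<in> carrier ?A"
    then have ST: "S \<in> operators Y Y" "T \<in> operators Y Y"
      by (auto simp: M_set_def operator_algebra_def)
    have S_not: "\<not> identity_factors_through Y S"
      using S by (simp add: M_set_def)
    have "\<not> identity_factors_through Y (T \<circ> S)"
      using identity_factors_through_of_comp[OF identity_operator_mem ST(2), of S] S_not
      by (simp only: comp_identity[OF operators_comp[OF ST(2) ST(1)]]) blast
    then show "T \<otimes>\<^bsub>?A\<^esub> S \<in> M_set Y"
      by (simp add: M_set_def operator_algebra_def operators_comp ST)
    have "\<not> identity_factors_through Y (S \<circ> T)"
      using identity_factors_through_of_comp[OF ST(2) identity_operator_mem, of S] S_not
      by (simp only: identity_comp[OF ST(1)]) blast
    then show "S \<otimes>\<^bsub>?A\<^esub> T \<in> M_set Y"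
      by (simp add: M_set_def operator_algebra_def operators_comp ST)
  qed
  have I_mem: "?I \<in> carrier ?A" "?I \<notin> M_set Y"
    using I by (auto simp: M_set_def operator_algebra_def identity_operator_mem)
  have contained: "J \<subseteq> M_set Y" if J: "ideal J ?A" and proper: "J \<noteq> carrier ?A" for J
  proof
    interpret J: ideal J ?A by (rule J)
    fix T assume T: "T \<in> J"
    have ops: "T \<in> operators Y Y"
      using T J.a_subset by (auto simp: operator_algebra_def)
    moreover have "\<not> identity_factors_through Y T"
    proof
      assume "identity_factors_through Y T"
      then obtain U V where U: "U \<in> operators Y Y" and V: "V \<in> operators Y Y"
        and eq: "?I = V \<circ> T \<circ> U"
        by (auto simp: identity_factors_through_def)
      have "(V \<otimes>\<^bsub>?A\<^esub> T) \<otimes>\<^bsub>?A\<^esub> U \<in> J"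
        using T U V by (intro J.I_l_closed J.I_r_closed) (auto simp: operator_algebra_def)
      then have "\<one>\<^bsub>?A\<^esub> \<in> J"
        by (simp add: operator_algebra_def eq)
      then show False
        using J.one_imp_carrier proper by blast
    qed
    ultimately show "T \<in> M_set Y"
      by (simp add: M_set_def)
  qed
  have max: "maximalideal (M_set Y) ?A"
  proof (rule maximalidealI[OF ideal])
    show "carrier ?A \<noteq> M_set Y"
      using I_mem by metis
    fix J assume J: "ideal J ?A" "M_set Y \<subseteq> J"
    then show "J = M_set Y \<or> J = carrier ?A"
      using contained[OF J(1)] by (metis subset_antisym)
  qed
  moreover have "J = M_set Y" if "maximalideal J ?A" for J
  proof -
    interpret J: maximalideal J ?A by (rule that)
    have "J \<subseteq> M_set Y"
      using contained[OF J.is_ideal] J.I_notcarr by simp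
    moreover have "M_set Y \<subseteq> carrier ?A"
      by (auto simp: M_set_def operator_algebra_def)
    ultimately have "M_set Y = J \<or> M_set Y = carrier ?A"
      by (rule J.I_maximal[OF ideal])
    then show ?thesis
      using I_mem by metis
  qed
  ultimately show ?thesis
    unfolding unique_maximal_ideal_def by (intro conjI allI impI)
qed

end

section \<open>Selecting a nearly diagonal submatrix\<close>

text \<open>
  Out-degrees at most \<open>d\<close> force some vertex to have in-degree at most \<open>d\<close>.  Choosing it and discarding
  its at most \<open>2 d\<close> neighbours uses up \<open>2 d + 1\<close> vertices per chosen one.
\<close>
lemma independent_set:
  fixes r :: "'a \<Rightarrow> 'a \<Rightarrow> bool"
  assumes "finite V" and "\<And>x. x \<in> V \<Longrightarrow> card {y \<in> V. r x y} \<le> d" and "n * (2 * d + 1) \<le> card V"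
  shows "\<exists>B\<subseteq>V. card B = n \<and> (\<forall>x\<in>B. \<forall>y\<in>B. x \<noteq> y \<longrightarrow> \<not> r x y)"
  using assms
proof (induction n arbitrary: V)
  case 0
  then show ?case by (intro exI[of _ "{}"]) auto
next
  case (Suc n)
  have fin: "finite V" by fact
  have "(\<Sum>y\<in>V. card {x \<in> V. r x y}) = card (Sigma V (\<lambda>y. {x \<in> V. r x y}))"
    by (simp add: fin)
  also have "\<dots> = card (Sigma V (\<lambda>x. {y \<in> V. r x y}))"
    by (rule bij_betw_same_card[of prod.swap]) (force simp: bij_betw_def inj_on_def)
  also have "\<dots> = (\<Sum>x\<in>V. card {y \<in> V. r x y})"
    by (simp add: fin)
  also have "\<dots> \<le> (\<Sum>x\<in>V. d)"
    by (intro sum_mono Suc.prems)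
  finally have total: "(\<Sum>y\<in>V. card {x \<in> V. r x y}) \<le> card V * d" by simp
  have "V \<noteq> {}" using Suc.prems(3) by auto
  have "\<exists>v\<in>V. card {x \<in> V. r x v} \<le> d"
  proof (rule ccontr)
    assume "\<not> ?thesis"
    then have "(\<Sum>y\<in>V. d) < (\<Sum>y\<in>V. card {x \<in> V. r x y})"
      using fin \<open>V \<noteq> {}\<close> by (intro sum_strict_mono) auto
    then show False using total by simp
  qed
  then obtain v where v: "v \<in> V" "card {x \<in> V. r x v} \<le> d" by blast
  define N where "N = {v} \<union> ({x \<in> V. r x v} \<union> {y \<in> V. r v y})"
  have "card N \<le> card {v} + card ({x \<in> V. r x v} \<union> {y \<in> V. r v y})"
    unfolding N_def by (rule card_Un_le)
  also have "\<dots> \<le> 1 + (card {x \<in> V. r x v} + card {y \<in> V. r v y})"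
    using card_Un_le[of "{x \<in> V. r x v}" "{y \<in> V. r v y}"] by simp
  finally have "card N \<le> 1 + (card {x \<in> V. r x v} + card {y \<in> V. r v y})" .
  then have N: "card N \<le> 2 * d + 1"
    using v Suc.prems(2)[of v] by simp
  have "N \<subseteq> V" using v by (auto simp: N_def)
  then have "card (V - N) = card V - card N"
    using fin by (meson card_Diff_subset finite_subset)
  then have big: "n * (2 * d + 1) \<le> card (V - N)"
    using N Suc.prems(3) by simp
  have deg: "card {y \<in> V - N. r x y} \<le> d" if "x \<in> V - N" for x
    using Suc.prems(2)[of x] that card_mono[of "{y \<in> V. r x y}" "{y \<in> V - N. r x y}"] fin by force
  obtain B where B: "B \<subseteq> V - N" "card B = n" "\<forall>x\<in>B. \<forall>y\<in>B. x \<noteq> y \<longrightarrow> \<not> r x y"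
    using Suc.IH[OF _ deg big] fin by auto
  have "finite B" using B(1) fin finite_subset by blast
  moreover have "v \<notin> B" using B by (auto simp: N_def)
  ultimately show ?case
    using B v by (intro exI[of _ "insert v B"]) (auto simp: N_def)
qed

text \<open>
  Since \<open>\<bar>t\<bar> + \<bar>1 - t\<bar> \<ge> 1\<close>, at least half of the diagonal entries of the matrix, or of the identity
  minus the matrix, are large; among these indices an independent set is chosen in the graph of
  entries of modulus at least \<open>\<epsilon>\<close>.  Transposing the matrix turns a bound for columns into one for rows.
\<close>
lemma independent_set_diagonal:
  fixes t :: "nat \<Rightarrow> nat \<Rightarrow> 'k::real_normed_field"
  assumes deg: "(\<forall>i\<le>N. card {j. j \<le> N \<and> \<epsilon> \<le> norm (t i j)} \<le> d) \<or>
      (\<forall>j\<le>N. card {i. i \<le> N \<and> \<epsilon> \<le> norm (t i j)} \<le> d)"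
    and N: "2 * (n * (2 * d + 1)) \<le> N"
  shows "\<exists>B\<subseteq>{..N}. card B = n \<and> (\<forall>i\<in>B. \<forall>j\<in>B. i \<noteq> j \<longrightarrow> norm (t i j) < \<epsilon>) \<and>
    ((\<forall>i\<in>B. 1/2 \<le> norm (t i i)) \<or> (\<forall>i\<in>B. 1/2 \<le> norm (1 - t i i)))"
proof -
  define V where "V b = {i. i \<le> N \<and> 1/2 \<le> norm (if b then t i i else 1 - t i i)}" for b
  have V: "finite (V b)" "V b \<subseteq> {..N}" for b
    by (auto simp: V_def)
  have "{..N} \<subseteq> V True \<union> V False"
  proof
    fix i assume "i \<in> {..N}"
    moreover have "1 \<le> norm (t i i) + norm (1 - t i i)"
      using norm_triangle_ineq[of "t i i" "1 - t i i"] by simp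
    ultimately show "i \<in> V True \<union> V False"
      by (auto simp: V_def)
  qed
  then have "card {..N} \<le> card (V True \<union> V False)"
    using V by (intro card_mono) auto
  also have "\<dots> \<le> card (V True) + card (V False)"
    by (rule card_Un_le)
  finally have "Suc N \<le> card (V True) + card (V False)"
    by simp
  then have "n * (2 * d + 1) \<le> card (V True) \<or> n * (2 * d + 1) \<le> card (V False)"
    using N by linarith
  then obtain b where b: "n * (2 * d + 1) \<le> card (V b)"
    by blast
  have "\<exists>B\<subseteq>V b. card B = n \<and> (\<forall>x\<in>B. \<forall>y\<in>B. x \<noteq> y \<longrightarrow> \<not> (\<epsilon> \<le> norm (t x y)))"
    using deg
  proof
    assume d: "\<forall>i\<le>N. card {j. j \<le> N \<and> \<epsilon> \<le> norm (t i j)} \<le> d"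
    show ?thesis
    proof (rule independent_set[OF V(1) _ b])
      fix i assume "i \<in> V b"
      then have "i \<le> N" by (simp add: V_def)
      moreover have "card {j \<in> V b. \<epsilon> \<le> norm (t i j)} \<le> card {j. j \<le> N \<and> \<epsilon> \<le> norm (t i j)}"
        by (intro card_mono) (auto simp: V_def)
      ultimately show "card {j \<in> V b. \<epsilon> \<le> norm (t i j)} \<le> d"
        using d by (meson le_trans)
    qed
  next
    assume d: "\<forall>j\<le>N. card {i. i \<le> N \<and> \<epsilon> \<le> norm (t i j)} \<le> d"
    have "\<exists>B\<subseteq>V b. card B = n \<and> (\<forall>x\<in>B. \<forall>y\<in>B. x \<noteq> y \<longrightarrow> \<not> (\<epsilon> \<le> norm (t y x)))"
    proof (rule independent_set[OF V(1) _ b])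
      fix i assume "i \<in> V b"
      then have "i \<le> N" by (simp add: V_def)
      moreover have "card {j \<in> V b. \<epsilon> \<le> norm (t j i)} \<le> card {j. j \<le> N \<and> \<epsilon> \<le> norm (t j i)}"
        by (intro card_mono) (auto simp: V_def)
      ultimately show "card {j \<in> V b. \<epsilon> \<le> norm (t j i)} \<le> d"
        using d by (meson le_trans)
    qed
    then obtain B where "B \<subseteq> V b" "card B = n" "\<forall>x\<in>B. \<forall>y\<in>B. x \<noteq> y \<longrightarrow> \<not> (\<epsilon> \<le> norm (t y x))"
      by (elim exE conjE)
    then show ?thesis by (intro exI[of _ B]) auto
  qed
  then obtain B where B: "B \<subseteq> V b" "card B = n" "\<forall>x\<in>B. \<forall>y\<in>B. x \<noteq> y \<longrightarrow> norm (t x y) < \<epsilon>"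
    by (auto simp: not_le)
  moreover have "(\<forall>i\<in>B. 1/2 \<le> norm (t i i)) \<or> (\<forall>i\<in>B. 1/2 \<le> norm (1 - t i i))"
  proof (cases b)
    case True
    then show ?thesis using B(1) by (auto simp: V_def)
  next
    case False
    then show ?thesis using B(1) by (auto simp: V_def)
  qed
  ultimately show ?thesis
    using V(2)[of b] by (intro exI[of _ B]) (simp add: subset_trans)
qed

text \<open>
  Here \<open>t n i k j\<close> is the matrix entry with row \<open>(n, i)\<close> and column \<open>(k, j)\<close>.  The result is a choice of
  \<open>n + 1\<close> coordinates \<open>b n i\<close> in the block \<open>m n\<close>, for each \<open>n\<close>, such that the submatrix at these coordinates
  is nearly diagonal and the diagonal entries of it, or of the identity minus it, stay away
  from \<open>0\<close>.  It need not be the same alternative in different blocks; but each alternative is inherited by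
  smaller sizes and larger tolerances, so one of them is available in arbitrarily late blocks for all
  sizes.  With that one fixed, the blocks are chosen inductively, each so late that its
  entries against all coordinates of the previously chosen blocks are small.
\<close>
lemma select_nearly_diagonal:
  fixes t :: "nat \<Rightarrow> nat \<Rightarrow> nat \<Rightarrow> nat \<Rightarrow> 'k::real_normed_field" and w :: "nat \<Rightarrow> real"
  assumes row: "\<And>n i \<epsilon>. \<lbrakk>i \<le> n; 0 < \<epsilon>\<rbrakk> \<Longrightarrow> \<exists>N. \<forall>k\<ge>N. \<forall>j\<le>k. norm (t n i k j) < \<epsilon>"
    and col: "\<And>n i \<epsilon>. \<lbrakk>i \<le> n; 0 < \<epsilon>\<rbrakk> \<Longrightarrow> \<exists>N. \<forall>k\<ge>N. \<forall>j\<le>k. norm (t k j n i) < \<epsilon>"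
    and block: "\<And>\<epsilon>. 0 < \<epsilon> \<Longrightarrow> \<exists>d. \<forall>n. (\<forall>i\<le>n. card {j. j \<le> n \<and> \<epsilon> \<le> norm (t n i n j)} \<le> d) \<or>
      (\<forall>j\<le>n. card {i. i \<le> n \<and> \<epsilon> \<le> norm (t n i n j)} \<le> d)"
    and w: "\<And>n. 0 < w n" "antimono w"
  obtains m b where "strict_mono (m :: nat \<Rightarrow> nat)"
    and "\<And>n. inj_on (b n) {..n}" and "\<And>n i. i \<le> n \<Longrightarrow> b n i \<le> m n"
    and "\<And>n i k j. \<lbrakk>i \<le> n; j \<le> k; (n, i) \<noteq> (k, j)\<rbrakk> \<Longrightarrow>
      norm (t (m n) (b n i) (m k) (b k j)) \<le> w n * w k"
    and "(\<forall>n. \<forall>i\<le>n. 1/2 \<le> norm (t (m n) (b n i) (m n) (b n i))) \<or>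
      (\<forall>n. \<forall>i\<le>n. 1/2 \<le> norm (1 - t (m n) (b n i) (m n) (b n i)))"
proof -
  define f where "f c N i = norm (if c then t N i N i else 1 - t N i N i)" for c N i
  (* The truth value c selects the alternative: large diagonal of t or of the identity minus t. *)
  define good where "good c n \<epsilon> N B \<longleftrightarrow> B \<subseteq> {..N} \<and> card B = Suc n \<and>
    (\<forall>i\<in>B. \<forall>j\<in>B. i \<noteq> j \<longrightarrow> norm (t N i N j) < \<epsilon>) \<and> (\<forall>i\<in>B. 1/2 \<le> f c N i)"
    for c n \<epsilon> N and B :: "nat set"
  have ex: "\<exists>c N B. N0 \<le> N \<and> good c n \<epsilon> N B" if eps: "0 < \<epsilon>" for n N0 \<epsilon>
  proof -
    obtain d where d: "\<And>n. (\<forall>i\<le>n. card {j. j \<le> n \<and> \<epsilon> \<le> norm (t n i n j)} \<le> d) \<or>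
      (\<forall>j\<le>n. card {i. i \<le> n \<and> \<epsilon> \<le> norm (t n i n j)} \<le> d)"
      using block[OF eps] by blast
    (* Half of the diagonal must still contain n + 1 groups of 2 d + 1 indices. *)
    define N where "N = max N0 (2 * (Suc n * (2 * d + 1)))"
    have N: "N0 \<le> N" "2 * (Suc n * (2 * d + 1)) \<le> N"
      unfolding N_def by (rule max.cobounded1, rule max.cobounded2)
    obtain B where B: "B \<subseteq> {..N}" "card B = Suc n"
      "\<forall>i\<in>B. \<forall>j\<in>B. i \<noteq> j \<longrightarrow> norm (t N i N j) < \<epsilon>"
      "(\<forall>i\<in>B. 1/2 \<le> norm (t N i N i)) \<or> (\<forall>i\<in>B. 1/2 \<le> norm (1 - t N i N i))"
      using independent_set_diagonal[of N \<epsilon> "\<lambda>i j. t N i N j" d "Suc n", OF d N(2)] by (elim exE conjE)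
    then have "good True n \<epsilon> N B \<or> good False n \<epsilon> N B"
      by (simp add: good_def f_def)
    then show ?thesis using N(1) by meson
  qed
  have mono: "\<exists>B'. good c n \<epsilon> N B'"
    if g: "good c n' \<epsilon>' N B" and le: "n \<le> n'" "\<epsilon>' \<le> \<epsilon>" for c n n' \<epsilon> \<epsilon>' N B
  proof -
    have "Suc n \<le> card B" using g le by (simp add: good_def)
    then obtain B' where B': "B' \<subseteq> B" "card B' = Suc n"
      by (rule obtain_subset_with_card_n)
    have "good c n \<epsilon> N B'"
      unfolding good_def
    proof (intro conjI ballI impI)
      fix i j assume "i \<in> B'" "j \<in> B'" "i \<noteq> j"
      then have "norm (t N i N j) < \<epsilon>'" using g B'(1) unfolding good_def by blast
      then show "norm (t N i N j) < \<epsilon>" using le by simp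
    next
      show "B' \<subseteq> {..N}" "card B' = Suc n" using g B' by (auto simp: good_def)
      fix i assume "i \<in> B'"
      then show "1/2 \<le> f c N i" using g B'(1) unfolding good_def by blast
    qed
    then show ?thesis by (rule exI)
  qed
  have "\<exists>c. \<forall>n \<epsilon> N0. 0 < \<epsilon> \<longrightarrow> (\<exists>N\<ge>N0. \<exists>B. good c n \<epsilon> N B)"
  proof (rule ccontr)
    assume "\<not> ?thesis"
    then have "\<forall>c. \<exists>n \<epsilon> N0. 0 < \<epsilon> \<and> (\<forall>N B. N0 \<le> N \<longrightarrow> \<not> good c n \<epsilon> N B)"
      by simp
    then obtain n \<epsilon> N0 where "\<forall>c. 0 < \<epsilon> c \<and> (\<forall>N B. N0 c \<le> N \<longrightarrow> \<not> good c (n c) (\<epsilon> c) N B)"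
      by (simp only: choice_iff) blast
    then have bad: "\<And>c. 0 < \<epsilon> c" "\<And>c N B. N0 c \<le> N \<Longrightarrow> \<not> good c (n c) (\<epsilon> c) N B"
      by auto
    (* If both alternatives failed, a set serving both failing demands at once would be a
       contradiction, whichever alternative it realises. *)
    obtain c N B where g: "max (N0 True) (N0 False) \<le> N"
      "good c (max (n True) (n False)) (min (\<epsilon> True) (\<epsilon> False)) N B"
      using ex[of "min (\<epsilon> True) (\<epsilon> False)" "max (N0 True) (N0 False)" "max (n True) (n False)"] bad(1)
      by auto
    have "\<exists>B'. good c (n c) (\<epsilon> c) N B'"
      by (rule mono[OF g(2)]) (cases c; simp)+
    moreover have "N0 c \<le> N"
      using g(1) by (cases c) auto
    ultimately show False
      using bad(2) by blast
  qed
  then obtain c where c: "\<And>n \<epsilon> N0. 0 < \<epsilon> \<Longrightarrow> \<exists>N\<ge>N0. \<exists>B. good c n \<epsilon> N B"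
    by blast
  (* A block contains finitely many coordinates, so the decay along rows and columns is uniform
     over an initial segment of blocks. *)
  have far: "\<exists>N. \<forall>k\<ge>N. \<forall>n\<le>M. \<forall>i\<le>n. \<forall>j\<le>k. norm (t n i k j) < \<epsilon> \<and> norm (t k j n i) < \<epsilon>"
    if "0 < \<epsilon>" for M \<epsilon>
  proof -
    have "\<forall>a\<in>Sigma {..M} (\<lambda>n. {..n}). \<forall>\<^sub>F k in sequentially. \<forall>j\<le>k.
        norm (t (fst a) (snd a) k j) < \<epsilon> \<and> norm (t k j (fst a) (snd a)) < \<epsilon>"
    proof
      fix a assume a: "a \<in> Sigma {..M} (\<lambda>n. {..n})"
      then have "snd a \<le> fst a" by auto
      from row[OF this that] col[OF this that] obtain N1 N2 where
        "\<forall>k\<ge>N1. \<forall>j\<le>k. norm (t (fst a) (snd a) k j) < \<epsilon>"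
        "\<forall>k\<ge>N2. \<forall>j\<le>k. norm (t k j (fst a) (snd a)) < \<epsilon>" by blast
      then show "\<forall>\<^sub>F k in sequentially. \<forall>j\<le>k.
          norm (t (fst a) (snd a) k j) < \<epsilon> \<and> norm (t k j (fst a) (snd a)) < \<epsilon>"
        unfolding eventually_sequentially by (intro exI[of _ "max N1 N2"]) auto
    qed
    then have "\<forall>\<^sub>F k in sequentially. \<forall>a\<in>Sigma {..M} (\<lambda>n. {..n}). \<forall>j\<le>k.
        norm (t (fst a) (snd a) k j) < \<epsilon> \<and> norm (t k j (fst a) (snd a)) < \<epsilon>"
      by (intro eventually_ball_finite) auto
    then obtain N where N: "\<And>k a j. \<lbrakk>N \<le> k; a \<in> Sigma {..M} (\<lambda>n. {..n}); j \<le> k\<rbrakk> \<Longrightarrow>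
        norm (t (fst a) (snd a) k j) < \<epsilon> \<and> norm (t k j (fst a) (snd a)) < \<epsilon>"
      unfolding eventually_sequentially by blast
    show ?thesis
    proof (intro exI[of _ N] allI impI)
      fix k n i j assume "N \<le> k" "n \<le> M" "i \<le> n" "j \<le> k"
      then show "norm (t n i k j) < \<epsilon> \<and> norm (t k j n i) < \<epsilon>"
        using N[of k "(n, i)" j] by simp
    qed
  qed
  (* As w decreases, the tolerance of the later of two blocks is below the product w n * w k. *)
  define \<eta> where "\<eta> n = w n * w n" for n
  have \<eta>: "0 < \<eta> n" for n using w(1)[of n] by (simp add: \<eta>_def)
  (* Controlling the entries against every block up to the last chosen one makes the relation
     between consecutive choices sufficient for all pairs. *)
  define Q where "Q n s s' \<longleftrightarrow> fst s < fst s' \<and>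
    (\<forall>k\<le>fst s. \<forall>i\<le>k. \<forall>j\<le>fst s'. norm (t k i (fst s') j) < \<eta> (Suc n) \<and> norm (t (fst s') j k i) < \<eta> (Suc n))"
    for n and s s' :: "nat \<times> nat set"
  have "\<exists>s. \<forall>n. good c n (\<eta> n) (fst (s n)) (snd (s n)) \<and> Q n (s n) (s (Suc n))"
  proof (rule dependent_nat_choice)
    show "\<exists>s. good c 0 (\<eta> 0) (fst s) (snd s)"
      using c[OF \<eta>, of 0 0 0] by auto
    fix s :: "nat \<times> nat set" and n
    obtain N where N: "\<forall>k\<ge>N. \<forall>l\<le>fst s. \<forall>i\<le>l. \<forall>j\<le>k.
        norm (t l i k j) < \<eta> (Suc n) \<and> norm (t k j l i) < \<eta> (Suc n)"
      using far[OF \<eta>] by blast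
    obtain N' B where "max N (Suc (fst s)) \<le> N'" "good c (Suc n) (\<eta> (Suc n)) N' B"
      using c[OF \<eta>] by blast
    then show "\<exists>s'. good c (Suc n) (\<eta> (Suc n)) (fst s') (snd s') \<and> Q n s s'"
      using N by (intro exI[of _ "(N', B)"]) (auto simp: Q_def)
  qed
  then obtain s where s: "\<And>n. good c n (\<eta> n) (fst (s n)) (snd (s n))" "\<And>n. Q n (s n) (s (Suc n))"
    by blast
  define m where "m n = fst (s n)" for n
  have m: "strict_mono m"
    using s(2) by (auto simp: strict_mono_Suc_iff m_def Q_def)
  have "\<exists>b. bij_betw b {..n} (snd (s n))" for n
  proof (rule finite_same_card_bij)
    show "finite (snd (s n))" "card {..n} = card (snd (s n))"
      using s(1)[of n] by (auto simp: good_def intro: finite_subset)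
  qed auto
  then obtain b where b: "\<And>n. bij_betw (b n) {..n} (snd (s n))"
    by metis
  have b_mem: "b n i \<in> snd (s n)" if "i \<le> n" for n i
    using b[of n] that by (auto simp: bij_betw_def)
  have b_inj: "inj_on (b n) {..n}" for n
    using b by (simp add: bij_betw_def)
  have b_le: "b n i \<le> m n" if "i \<le> n" for n i
    using b_mem[OF that] s(1)[of n] by (auto simp: good_def m_def)
  have cross: "norm (t (m n) i (m k) j) < \<eta> k \<and> norm (t (m k) j (m n) i) < \<eta> k"
    if "n < k" "i \<le> m n" "j \<le> m k" for n k i j
  proof -
    obtain l where l: "k = Suc l" "n \<le> l"
      using \<open>n < k\<close> by (cases k) auto
    then have "m n \<le> m l" using m by (simp add: strict_mono_less_eq)
    then show ?thesis
      using s(2)[of l] that(2,3) unfolding Q_def l(1) m_def by blast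
  qed
  show thesis
  proof (rule that[OF m b_inj b_le])
    fix n i k j :: nat assume ij: "i \<le> n" "j \<le> k" "(n, i) \<noteq> (k, j)"
    have "norm (t (m n) (b n i) (m k) (b k j)) < \<eta> (max n k)"
    proof (cases n k rule: linorder_cases)
      case less
      then show ?thesis
        using cross[OF less b_le b_le] ij by (simp add: max_def)
    next
      case greater
      then show ?thesis
        using cross[OF greater b_le b_le] ij by (simp add: max_def)
    next
      case equal
      then have "b n i \<noteq> b k j"
        using ij b_inj[of n] by (auto simp: inj_on_def)
      then show ?thesis
        using s(1)[of n] b_mem[of i n] b_mem[of j k] ij equal by (auto simp: good_def m_def)
    qed
    also have "\<eta> (max n k) \<le> w n * w k"
      unfolding \<eta>_def using w(2) by (intro mult_mono) (auto simp: antimono_def less_imp_le[OF w(1)])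
    finally show "norm (t (m n) (b n i) (m k) (b k j)) \<le> w n * w k" by simp
  next
    have "1/2 \<le> f c (m n) (b n i)" if "i \<le> n" for n i
      using s(1)[of n] b_mem[OF that] by (auto simp: good_def m_def)
    then show "(\<forall>n. \<forall>i\<le>n. 1/2 \<le> norm (t (m n) (b n i) (m n) (b n i))) \<or>
      (\<forall>n. \<forall>i\<le>n. 1/2 \<le> norm (1 - t (m n) (b n i) (m n) (b n i)))"
      by (cases c) (auto simp: f_def)
  qed
qed

section \<open>Spaces with blocks of coordinates\<close>

text \<open>
  Block \<open>n\<close> has the \<open>n + 1\<close> coordinates \<open>(n, i)\<close> with \<open>i \<le> n\<close>, with unit vectors \<open>e n i\<close> and coordinate
  functionals \<open>cor n i\<close>.
\<close>
locale block_system = normed_vspace Y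
  for Y :: "('k::real_normed_field, 'v::ab_group_add) normed_space" +
  fixes e :: "nat \<Rightarrow> nat \<Rightarrow> 'v" and cor :: "nat \<Rightarrow> nat \<Rightarrow> 'v \<Rightarrow> 'k"
  assumes e_mem: "i \<le> n \<Longrightarrow> e n i \<in> carrier Y"
    and nrm_e: "i \<le> n \<Longrightarrow> nrm Y (e n i) \<le> 1"
    and cor_op: "i \<le> n \<Longrightarrow> cor n i \<in> operators Y scalar_space"
    and cor_le: "\<lbrakk>i \<le> n; x \<in> carrier Y\<rbrakk> \<Longrightarrow> norm (cor n i x) \<le> nrm Y x"
    and cor_e: "\<lbrakk>i \<le> n; j \<le> m\<rbrakk> \<Longrightarrow> cor n i (e m j) = (if n = m \<and> i = j then 1 else 0)"
begin

text \<open>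
  The value \<open>0\<close> outside the carrier makes the projection a member of \<open>operators Y Y\<close>.
\<close>
definition initial_proj :: "nat \<Rightarrow> 'v \<Rightarrow> 'v" where
  "initial_proj N x = (if x \<in> carrier Y then \<Sum>n<N. \<Sum>i\<le>n. scl Y (cor n i x) (e n i) else 0)"

lemma coord_mem: "i \<le> n \<Longrightarrow> scl Y c (e n i) \<in> carrier Y"
  by (simp add: scl_mem e_mem)

lemma initial_proj_mem: "initial_proj N x \<in> carrier Y"
  unfolding initial_proj_def by (auto intro!: sum_mem coord_mem simp: zero_mem)

lemma cor_scl: "\<lbrakk>i \<le> n; x \<in> carrier Y\<rbrakk> \<Longrightarrow> cor n i (scl Y c x) = c * cor n i x"
  using op_scl[OF cor_op] by simp

lemma nrm_combination_le:
  "nrm Y (\<Sum>n<N. \<Sum>i\<le>n. scl Y (c n i) (e n i)) \<le> (\<Sum>n<N. \<Sum>i\<le>n. norm (c n i))"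
proof -
  have "nrm Y (\<Sum>n<N. \<Sum>i\<le>n. scl Y (c n i) (e n i)) \<le> (\<Sum>n<N. nrm Y (\<Sum>i\<le>n. scl Y (c n i) (e n i)))"
    by (intro nrm_sum sum_mem coord_mem) simp
  also have "\<dots> \<le> (\<Sum>n<N. \<Sum>i\<le>n. nrm Y (scl Y (c n i) (e n i)))"
    by (intro sum_mono nrm_sum coord_mem) simp
  also have "\<dots> \<le> (\<Sum>n<N. \<Sum>i\<le>n. norm (c n i))"
    by (intro sum_mono) (simp add: nrm_scl e_mem nrm_e mult_left_le)
  finally show ?thesis .
qed

lemma op_initial_proj:
  assumes T: "T \<in> operators Y Z" and x: "x \<in> carrier Y"
  shows "T (initial_proj N x) = (\<Sum>n<N. \<Sum>i\<le>n. scl Z (cor n i x) (T (e n i)))"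
proof -
  have "T (initial_proj N x) = (\<Sum>n<N. T (\<Sum>i\<le>n. scl Y (cor n i x) (e n i)))"
    unfolding initial_proj_def using x
    by (simp only: if_True) (intro op_sum[OF T] sum_mem coord_mem, simp)
  also have "\<dots> = (\<Sum>n<N. \<Sum>i\<le>n. scl Z (cor n i x) (T (e n i)))"
    by (intro sum.cong refl, subst op_sum[OF T]) (auto simp: coord_mem op_scl[OF T] e_mem)
  finally show ?thesis .
qed

lemma cor_initial_proj:
  assumes "i \<le> n" and x: "x \<in> carrier Y"
  shows "cor n i (initial_proj N x) = (if n < N then cor n i x else 0)"
proof -
  have "cor n i (initial_proj N x) = (\<Sum>m<N. \<Sum>j\<le>m. cor m j x * cor n i (e m j))"
    using op_initial_proj[OF cor_op[OF assms(1)] x] by simp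
  also have "\<dots> = (\<Sum>m<N. \<Sum>j\<le>m. if n = m then (if i = j then cor n j x else 0) else 0)"
    by (intro sum.cong refl) (auto simp: cor_e assms(1))
  also have "\<dots> = (\<Sum>m<N. if n = m then cor n i x else 0)"
    by (intro sum.cong refl) (use assms(1) in auto)
  finally show ?thesis by simp
qed

lemma initial_proj_eq_of_cor:
  assumes "x \<in> carrier Y" "y \<in> carrier Y" "\<And>n i. \<lbrakk>n < N; i \<le> n\<rbrakk> \<Longrightarrow> cor n i x = cor n i y"
  shows "initial_proj N x = initial_proj N y"
  unfolding initial_proj_def using assms by (auto intro!: sum.cong)

lemma initial_proj_initial_proj:
  assumes x: "x \<in> carrier Y"
  shows "initial_proj N (initial_proj M x) = initial_proj (min N M) x"
proof -
  have "initial_proj N (initial_proj M x) =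
      (\<Sum>n<N. if n < M then \<Sum>i\<le>n. scl Y (cor n i x) (e n i) else 0)"
    unfolding initial_proj_def[of N] using x
    by (auto simp: initial_proj_mem cor_initial_proj scl_zero_left e_mem intro!: sum.cong)
  also have "\<dots> = (\<Sum>n\<in>{..<N} \<inter> {n. n < M}. \<Sum>i\<le>n. scl Y (cor n i x) (e n i))"
    by (subst sum.inter_restrict) auto
  also have "{..<N} \<inter> {n. n < M} = {..<min N M}"
    by auto
  finally show ?thesis
    using x by (simp add: initial_proj_def)
qed

lemma initial_proj_op: "initial_proj N \<in> operators Y Y"
proof (rule operatorsI[where C = "\<Sum>n<N. \<Sum>i\<le>n. 1"])
  fix x assume x: "x \<in> carrier Y"
  have "nrm Y (initial_proj N x) \<le> (\<Sum>n<N. \<Sum>i\<le>n. norm (cor n i x))"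
    using nrm_combination_le[where c = "\<lambda>n i. cor n i x" and N = N] x by (simp add: initial_proj_def)
  also have "\<dots> \<le> (\<Sum>n<N. \<Sum>i\<le>n. nrm Y x)"
    by (intro sum_mono cor_le x) auto
  finally show "nrm Y (initial_proj N x) \<le> (\<Sum>n<N. \<Sum>i\<le>n. 1) * nrm Y x"
    by (simp add: sum_distrib_right)
next
  fix x y assume x: "x \<in> carrier Y" and y: "y \<in> carrier Y"
  have "initial_proj N (x + y) =
      (\<Sum>n<N. \<Sum>i\<le>n. scl Y (cor n i x) (e n i) + scl Y (cor n i y) (e n i))"
    unfolding initial_proj_def using x y
    by (auto simp: add_mem op_add[OF cor_op] scl_add_left e_mem intro!: sum.cong)
  then show "initial_proj N (x + y) = initial_proj N x + initial_proj N y"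
    using x y by (simp add: initial_proj_def sum.distrib)
next
  fix c x assume x: "x \<in> carrier Y"
  have "initial_proj N (scl Y c x) = (\<Sum>n<N. \<Sum>i\<le>n. scl Y c (scl Y (cor n i x) (e n i)))"
    unfolding initial_proj_def using x
    by (auto simp: scl_mem cor_scl scl_scl e_mem intro!: sum.cong)
  also have "\<dots> = (\<Sum>n<N. scl Y c (\<Sum>i\<le>n. scl Y (cor n i x) (e n i)))"
    by (intro sum.cong refl scl_sum[symmetric] coord_mem) simp
  also have "\<dots> = scl Y c (\<Sum>n<N. \<Sum>i\<le>n. scl Y (cor n i x) (e n i))"
    by (intro scl_sum[symmetric] sum_mem coord_mem) simp
  finally show "initial_proj N (scl Y c x) = scl Y c (initial_proj N x)"
    using x by (simp add: initial_proj_def)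
qed (rule initial_proj_mem, simp add: initial_proj_def)

lemma cor_zero: "i \<le> n \<Longrightarrow> cor n i 0 = 0"
  by (rule op_zero[OF cor_op])

lemma initial_proj_e:
  assumes "i \<le> n"
  shows "initial_proj N (e n i) = (if n < N then e n i else 0)"
proof -
  have "initial_proj N (e n i) = (\<Sum>m<N. \<Sum>j\<le>m. if n = m then (if i = j then e n i else 0) else 0)"
    unfolding initial_proj_def using assms
    by (auto simp: e_mem cor_e scl_zero_left scl_one intro!: sum.cong)
  also have "\<dots> = (\<Sum>m<N. if n = m then e n i else 0)"
    by (intro sum.cong refl) (use assms in auto)
  finally show ?thesis by simp
qed

lemma nontrivial: "\<exists>x\<in>carrier Y. x \<noteq> 0"
proof
  show "e 0 0 \<noteq> 0"
    using cor_e[of 0 0 0 0] cor_zero[of 0 0] by auto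
qed (simp add: e_mem)

end

context normed_vspace
begin

lemma nrm_le_of_limit:
  assumes "\<And>k. s k \<in> carrier Y" "y \<in> carrier Y" "(\<lambda>k. nrm Y (s k - y)) \<longlonglongrightarrow> 0" "\<And>k. nrm Y (s k) \<le> c"
  shows "nrm Y y \<le> c"
proof (rule LIMSEQ_le_const)
  show "(\<lambda>k. nrm Y (s k - y) + c) \<longlonglongrightarrow> c"
    using tendsto_add[OF assms(3) tendsto_const[of c]] by simp
  have "nrm Y y \<le> nrm Y (s k - y) + c" for k
    using nrm_triangle_sub[OF assms(2) assms(1)[of k]] nrm_minus_commute[OF assms(2) assms(1)[of k]]
      assms(4)[of k] by linarith
  then show "\<exists>N. \<forall>n\<ge>N. nrm Y y \<le> nrm Y (s n - y) + c"
    by blast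
qed

lemma op_limit:
  assumes T: "T \<in> operators Y Z" and s: "\<And>k. s k \<in> carrier Y" "y \<in> carrier Y"
    and lim: "(\<lambda>k. nrm Y (s k - y)) \<longlonglongrightarrow> 0" and Z: "\<And>z. z \<in> carrier Z \<Longrightarrow> 0 \<le> nrm Z z"
  shows "(\<lambda>k. nrm Z (T (s k) - T y)) \<longlonglongrightarrow> 0"
proof -
  obtain C where C: "\<And>x. x \<in> carrier Y \<Longrightarrow> nrm Z (T x) \<le> C * nrm Y x"
    using op_bound[OF T] by blast
  show ?thesis
  proof (rule tendsto_sandwich[OF _ _ tendsto_const])
    show "(\<lambda>k. C * nrm Y (s k - y)) \<longlonglongrightarrow> 0"
      using tendsto_mult_right_zero[OF lim] by simp
    show "\<forall>\<^sub>F k in sequentially. 0 \<le> nrm Z (T (s k) - T y)"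
      using Z[OF op_mem[OF T diff_mem[OF s]]] by (simp add: op_diff[OF T s])
    show "\<forall>\<^sub>F k in sequentially. nrm Z (T (s k) - T y) \<le> C * nrm Y (s k - y)"
      using C[OF diff_mem[OF s]] by (simp add: op_diff[OF T s])
  qed
qed

end

locale complete_normed_vspace = normed_vspace +
  assumes complete: "\<lbrakk>\<And>k. s k \<in> carrier Y;
      \<And>\<epsilon>. 0 < \<epsilon> \<Longrightarrow> \<exists>K. \<forall>j\<ge>K. \<forall>k\<ge>K. nrm Y (s j - s k) < \<epsilon>\<rbrakk> \<Longrightarrow>
    \<exists>y\<in>carrier Y. (\<lambda>k. nrm Y (s k - y)) \<longlonglongrightarrow> 0"
begin

text \<open>
  The solution is the fixed point of the contraction \<open>y \<mapsto> z + F y\<close>, reached by iteration from \<open>0\<close>.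
\<close>
lemma contraction_equation_solvable:
  assumes F: "F \<in> operators Y Y" and half: "\<And>x. x \<in> carrier Y \<Longrightarrow> nrm Y (F x) \<le> nrm Y x / 2"
    and z: "z \<in> carrier Y"
  shows "\<exists>y\<in>carrier Y. y - F y = z"
proof -
  define s where "s k = ((\<lambda>y. z + F y) ^^ k) 0" for k
  have s_0: "s 0 = 0" and s_Suc: "s (Suc k) = z + F (s k)" for k
    by (simp_all add: s_def)
  have s: "s k \<in> carrier Y" for k
    by (induction k) (auto simp: s_0 s_Suc zero_mem add_mem z op_mem[OF F])
  have s_le: "nrm Y (s k) \<le> 2 * nrm Y z" for k
  proof (induction k)
    case 0
    then show ?case by (simp add: s_0 nrm_zero nrm_nonneg z)
  next
    case (Suc k)
    then show ?case
      using nrm_triangle[OF z op_mem[OF F s[of k]]] half[OF s[of k]] by (simp add: s_Suc)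
  qed
  have step: "nrm Y (s (k + i) - s k) \<le> (1/2) ^ k * (2 * nrm Y z)" for k i
  proof (induction k)
    case 0
    then show ?case using s_le[of i] by (simp add: s_0)
  next
    case (Suc k)
    have "s (Suc k + i) - s (Suc k) = F (s (k + i) - s k)"
      by (simp add: s_Suc op_diff[OF F] s)
    then show ?case
      using half[OF diff_mem[OF s[of "k + i"] s[of k]]] Suc by simp
  qed
  have "\<exists>y\<in>carrier Y. (\<lambda>k. nrm Y (s k - y)) \<longlonglongrightarrow> 0"
  proof (rule complete[OF s])
    fix \<epsilon> :: real assume "0 < \<epsilon>"
    have "(\<lambda>k. (1/2) ^ k * (2 * nrm Y z)) \<longlonglongrightarrow> 0 * (2 * nrm Y z)"
      by (intro tendsto_mult_right LIMSEQ_power_zero) simp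
    then have "\<forall>\<^sub>F k in sequentially. (1/2) ^ k * (2 * nrm Y z) < \<epsilon>"
      using \<open>0 < \<epsilon>\<close> by (intro order_tendstoD(2)) auto
    then obtain K where K: "\<And>k. K \<le> k \<Longrightarrow> (1/2) ^ k * (2 * nrm Y z) < \<epsilon>"
      by (auto simp: eventually_sequentially)
    have less: "nrm Y (s j - s k) < \<epsilon>" if "K \<le> k" "k \<le> j" for j k
      using step[of k "j - k"] K[OF that(1)] that(2) by simp
    have "nrm Y (s j - s k) < \<epsilon>" if "K \<le> k" "K \<le> j" for j k
      using less[of k j] less[of j k] that nrm_minus_commute[OF s[of j] s[of k]] by (cases "k \<le> j") auto
    then show "\<exists>K. \<forall>j\<ge>K. \<forall>k\<ge>K. nrm Y (s j - s k) < \<epsilon>"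
      by blast
  qed
  then obtain y where y: "y \<in> carrier Y" and lim: "(\<lambda>k. nrm Y (s k - y)) \<longlonglongrightarrow> 0"
    by blast
  have d: "s (Suc k) - (z + F y) = F (s k) - F y" for k
    by (simp add: s_Suc)
  have zF: "z + F y \<in> carrier Y"
    by (intro add_mem z op_mem[OF F] y)
  have "(\<lambda>k. nrm Y (s (Suc k) - (z + F y))) \<longlonglongrightarrow> 0"
    unfolding d by (rule op_limit[OF F s y lim nrm_nonneg])
  moreover have "(\<lambda>k. nrm Y (s (Suc k) - y)) \<longlonglongrightarrow> 0"
    using lim by (rule LIMSEQ_Suc)
  ultimately have "(\<lambda>k. nrm Y (s (Suc k) - y) + nrm Y (s (Suc k) - (z + F y))) \<longlonglongrightarrow> 0"
    using tendsto_add_zero by blast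
  moreover have "nrm Y (y - (z + F y)) \<le> nrm Y (s (Suc k) - y) + nrm Y (s (Suc k) - (z + F y))" for k
    using nrm_diff_triangle[OF y s zF, of "Suc k"] nrm_minus_commute[OF y s, of "Suc k"] by simp
  ultimately have "nrm Y (y - (z + F y)) \<le> 0"
    by (intro LIMSEQ_le_const) auto
  then have "y - (z + F y) = 0"
    using nrm_nonneg[OF diff_mem[OF y zF]] by (intro nrm_eq_0 diff_mem y zF) simp
  then have "y - F y = z"
    by (simp add: algebra_simps)
  then show ?thesis using y by blast
qed

lemma identity_minus_contraction_left_inverse:
  assumes F: "F \<in> operators Y Y" and half: "\<And>x. x \<in> carrier Y \<Longrightarrow> nrm Y (F x) \<le> nrm Y x / 2"
  shows "\<exists>G\<in>operators Y Y. G \<circ> (identity_operator Y - F) = identity_operator Y"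
proof -
  (* The lower bound gives uniqueness of the solution of y - F y = z, hence linearity of G, and
     also the boundedness of G. *)
  have bounded_below: "nrm Y y \<le> 2 * nrm Y (y - F y)" if "y \<in> carrier Y" for y
    using nrm_triangle_sub[OF that op_mem[OF F that]] half[OF that] by simp
  have unique: "y = y'" if "y \<in> carrier Y" "y' \<in> carrier Y" "y - F y = y' - F y'" for y y'
  proof -
    have "(y - y') - F (y - y') = (y - F y) - (y' - F y')"
      using that by (simp add: op_diff[OF F] algebra_simps)
    also have "\<dots> = 0"
      using that(3) by simp
    finally have "(y - y') - F (y - y') = 0" .
    then have "nrm Y (y - y') \<le> 0"
      using bounded_below[OF diff_mem[OF that(1,2)]] by (simp add: nrm_zero)
    then have "y - y' = 0"
      using nrm_nonneg[OF diff_mem[OF that(1,2)]] by (intro nrm_eq_0 diff_mem that) simp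
    then show ?thesis by simp
  qed
  define G where "G z = (if z \<in> carrier Y then SOME y. y \<in> carrier Y \<and> y - F y = z else 0)" for z
  have G: "G z \<in> carrier Y" "G z - F (G z) = z" if "z \<in> carrier Y" for z
    using someI_ex[of "\<lambda>y. y \<in> carrier Y \<and> y - F y = z"] contraction_equation_solvable[OF F half that] that
    by (auto simp: G_def)
  have G_eq: "G z = y" if "y \<in> carrier Y" "y - F y = z" for y z
  proof -
    have "z \<in> carrier Y"
      using that diff_mem[OF that(1) op_mem[OF F that(1)]] by simp
    then show ?thesis
      using unique[OF G(1) that(1)] G(2) that(2) by simp
  qed
  have "G \<in> operators Y Y"
  proof (rule operatorsI[where C = 2])
    fix x y assume x: "x \<in> carrier Y" and y: "y \<in> carrier Y"
    show "G (x + y) = G x + G y"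
    proof (rule G_eq)
      have "G x + G y - F (G x + G y) = (G x - F (G x)) + (G y - F (G y))"
        using G(1)[OF x] G(1)[OF y] by (simp add: op_add[OF F])
      then show "G x + G y - F (G x + G y) = x + y"
        by (simp only: G(2)[OF x] G(2)[OF y])
    qed (intro add_mem G x y)
  next
    fix c x assume x: "x \<in> carrier Y"
    show "G (scl Y c x) = scl Y c (G x)"
    proof (rule G_eq)
      have "scl Y c (G x) = scl Y c (G x - F (G x)) + scl Y c (F (G x))"
        using scl_add_right[OF diff_mem[OF G(1)[OF x] op_mem[OF F G(1)[OF x]]] op_mem[OF F G(1)[OF x]]]
        by (simp only: diff_add_cancel)
      then have "scl Y c (G x) - scl Y c (F (G x)) = scl Y c x"
        by (simp only: G(2)[OF x] add_diff_cancel_right')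
      then show "scl Y c (G x) - F (scl Y c (G x)) = scl Y c x"
        by (simp only: op_scl[OF F G(1)[OF x]])
    qed (intro scl_mem G x)
  next
    fix x assume x: "x \<in> carrier Y"
    show "nrm Y (G x) \<le> 2 * nrm Y x"
      using bounded_below[OF G(1)[OF x]] G(2)[OF x] by simp
  qed (use G in \<open>simp_all add: G_def\<close>)
  moreover have "G \<circ> (identity_operator Y - F) = identity_operator Y"
  proof
    fix x
    have "0 \<in> carrier Y" "F 0 = 0"
      by (simp_all add: zero_mem op_zero[OF F])
    then have "G 0 = 0" by (intro G_eq) simp_all
    then show "(G \<circ> (identity_operator Y - F)) x = identity_operator Y x"
      by (cases "x \<in> carrier Y") (simp_all add: identity_operator_def G_eq op_outside[OF F])
  qed
  ultimately show ?thesis by blast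
qed

end

text \<open>
  The operators demanded by \<open>spread\<close> embed the space onto a copy of itself sitting on some of the
  coordinates, and recover it from there; those demanded by \<open>multiplier\<close> divide by a diagonal that is
  bounded away from \<open>0\<close>.
\<close>
locale block_basis = block_system Y e cor + complete_normed_vspace Y
  for Y :: "('k::real_normed_field, 'v::ab_group_add) normed_space" and e cor +
  assumes initial_proj_tendsto: "x \<in> carrier Y \<Longrightarrow> (\<lambda>N. nrm Y (initial_proj N x - x)) \<longlonglongrightarrow> 0"
    and multiplier: "(\<And>n i. i \<le> n \<Longrightarrow> norm (a n i) \<le> K) \<Longrightarrow>
      \<exists>D\<in>operators Y Y. \<forall>x\<in>carrier Y. \<forall>n. \<forall>i\<le>n. cor n i (D x) = a n i * cor n i x"
    and spread: "\<lbrakk>strict_mono m; \<And>n. inj_on (b n) {..n}; \<And>n i. i \<le> n \<Longrightarrow> b n i \<le> m n\<rbrakk> \<Longrightarrow>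
      \<exists>R\<in>operators Y Y. \<exists>Q\<in>operators Y Y. (\<forall>n. \<forall>i\<le>n. R (e n i) = e (m n) (b n i)) \<and>
        (\<forall>x\<in>carrier Y. \<forall>n. \<forall>i\<le>n. cor n i (Q x) = cor (m n) (b n i) x)"
begin

lemma cor_tendsto_zero:
  assumes x: "x \<in> carrier Y" and "0 < \<epsilon>"
  shows "\<exists>N. \<forall>n\<ge>N. \<forall>i\<le>n. norm (cor n i x) < \<epsilon>"
proof -
  have "\<forall>\<^sub>F N in sequentially. nrm Y (initial_proj N x - x) < \<epsilon>"
    using initial_proj_tendsto[OF x] \<open>0 < \<epsilon>\<close> by (rule order_tendstoD(2))
  then obtain N where N: "nrm Y (initial_proj N x - x) < \<epsilon>"
    by (auto simp: eventually_sequentially)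
  have "norm (cor n i x) < \<epsilon>" if "N \<le> n" "i \<le> n" for n i
  proof -
    have "cor n i (initial_proj N x - x) = - cor n i x"
      using that x by (simp add: op_diff[OF cor_op] initial_proj_mem cor_initial_proj)
    then show ?thesis
      using cor_le[OF that(2) diff_mem[OF initial_proj_mem[of N x] x]] N by simp
  qed
  then show ?thesis by blast
qed

text \<open>
  The weights of all coordinates sum to \<open>1\<close>.  Consequently a matrix whose entries are bounded by products
  of two weights has a bounded sum of moduli.
\<close>
definition weight :: "nat \<Rightarrow> real" where
  "weight n = (1/2) ^ Suc n / real (Suc n)"

lemma weight_pos: "0 < weight n"
  by (simp add: weight_def)

lemma antimono_weight: "antimono weight"
  unfolding weight_def by (intro antimonoI frac_le power_decreasing) auto

lemma sum_weight_le: "(\<Sum>n<N. \<Sum>i\<le>n. weight n) \<le> 1"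
proof -
  have "(\<Sum>n<N. \<Sum>i\<le>n. weight n) = (\<Sum>n<N. (1/2) ^ Suc n)"
    by (intro sum.cong refl) (simp add: weight_def del: of_nat_Suc)
  also have "\<dots> = 1 - (1/2) ^ N"
    by (induction N) auto
  finally show ?thesis by simp
qed

text \<open>
  Unit vectors and coordinate functionals have norm at most \<open>1\<close>, so on finitely supported vectors, and
  after truncating the result, the norm is at most the sum of the moduli of the entries.  Both
  truncations are then removed by a limit.
\<close>
lemma nrm_le_of_small_matrix:
  assumes F: "F \<in> operators Y Y" and x: "x \<in> carrier Y"
    and small: "\<And>n i m j. \<lbrakk>i \<le> n; j \<le> m\<rbrakk> \<Longrightarrow> norm (cor n i (F (e m j))) \<le> weight n * weight m / 2"
  shows "nrm Y (F x) \<le> nrm Y x / 2"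
proof -
  have fin: "nrm Y (initial_proj M (F (initial_proj N x))) \<le> nrm Y x / 2" for M N
  proof -
    have row: "norm (cor n i (F (initial_proj N x))) \<le> weight n * (nrm Y x / 2)" if "i \<le> n" for n i
    proof -
      have "cor n i \<circ> F \<in> operators Y scalar_space"
        by (rule operators_comp[OF cor_op[OF that] F])
      from op_initial_proj[OF this x, of N]
      have "norm (cor n i (F (initial_proj N x))) = norm (\<Sum>m<N. \<Sum>j\<le>m. cor m j x * cor n i (F (e m j)))"
        by simp
      also have "\<dots> \<le> (\<Sum>m<N. \<Sum>j\<le>m. norm (cor m j x * cor n i (F (e m j))))"
        by (intro order_trans[OF norm_sum] sum_mono order_refl)
      also have "\<dots> \<le> (\<Sum>m<N. \<Sum>j\<le>m. nrm Y x * (weight n * weight m / 2))"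
        unfolding norm_mult by (intro sum_mono mult_mono cor_le small[OF that] x nrm_nonneg norm_ge_zero) auto
      also have "\<dots> = weight n * (nrm Y x / 2) * (\<Sum>m<N. \<Sum>j\<le>m. weight m)"
        unfolding sum_distrib_left by (intro sum.cong refl) simp
      also have "\<dots> \<le> weight n * (nrm Y x / 2) * 1"
        by (intro mult_left_mono sum_weight_le) (simp add: nrm_nonneg x less_imp_le[OF weight_pos])
      finally show ?thesis by simp
    qed
    have y: "F (initial_proj N x) \<in> carrier Y"
      by (intro op_mem[OF F] initial_proj_mem)
    have "nrm Y (initial_proj M (F (initial_proj N x))) \<le> (\<Sum>n<M. \<Sum>i\<le>n. norm (cor n i (F (initial_proj N x))))"
      using nrm_combination_le[where c = "\<lambda>n i. cor n i (F (initial_proj N x))" and N = M] y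
      by (simp add: initial_proj_def[of M])
    also have "\<dots> \<le> (\<Sum>n<M. \<Sum>i\<le>n. weight n * (nrm Y x / 2))"
      by (intro sum_mono row) simp
    also have "\<dots> = (\<Sum>n<M. \<Sum>i\<le>n. weight n) * (nrm Y x / 2)"
      unfolding sum_distrib_right by simp
    also have "\<dots> \<le> 1 * (nrm Y x / 2)"
      by (intro mult_right_mono sum_weight_le) (simp add: nrm_nonneg x)
    finally show ?thesis by simp
  qed
  have "nrm Y (initial_proj M (F x)) \<le> nrm Y x / 2" for M
  proof (rule nrm_le_of_limit[OF _ _ _ fin[of M]])
    show "initial_proj M (F (initial_proj N x)) \<in> carrier Y" for N
      by (rule initial_proj_mem)
    show "initial_proj M (F x) \<in> carrier Y" by (rule initial_proj_mem)
    show "(\<lambda>N. nrm Y (initial_proj M (F (initial_proj N x)) - initial_proj M (F x))) \<longlonglongrightarrow> 0"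
      using op_limit[OF operators_comp[OF initial_proj_op F] initial_proj_mem x initial_proj_tendsto[OF x] nrm_nonneg]
      by simp
  qed
  then show ?thesis
    using nrm_le_of_limit[OF initial_proj_mem op_mem[OF F x] initial_proj_tendsto[OF op_mem[OF F x]]]
    by blast
qed

text \<open>
  With \<open>R\<close> and \<open>Q\<close> from \<open>spread\<close> and \<open>D\<close> the division by the diagonal, \<open>V = D Q T R\<close> has ones on its
  diagonal and small entries elsewhere.  So \<open>I - V\<close> has norm at most \<open>1/2\<close> and \<open>V\<close> has a left inverse.
\<close>
lemma identity_factors_through_of_nearly_diagonal:
  assumes T: "T \<in> operators Y Y"
    and m: "strict_mono m" and b: "\<And>n. inj_on (b n) {..n}" "\<And>n i. i \<le> n \<Longrightarrow> b n i \<le> m n"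
    and off: "\<And>n i k j. \<lbrakk>i \<le> n; j \<le> k; (n, i) \<noteq> (k, j)\<rbrakk> \<Longrightarrow>
      norm (cor (m n) (b n i) (T (e (m k) (b k j)))) \<le> weight n / 2 * (weight k / 2)"
    and diag: "\<And>n i. i \<le> n \<Longrightarrow> 1/2 \<le> norm (cor (m n) (b n i) (T (e (m n) (b n i))))"
  shows "identity_factors_through Y T"
proof -
  obtain R Q where R: "R \<in> operators Y Y" and Q: "Q \<in> operators Y Y"
    and R_e: "\<And>n i. i \<le> n \<Longrightarrow> R (e n i) = e (m n) (b n i)"
    and cor_Q: "\<And>x n i. \<lbrakk>x \<in> carrier Y; i \<le> n\<rbrakk> \<Longrightarrow> cor n i (Q x) = cor (m n) (b n i) x"
    using spread[OF m b] by metis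
  define t where "t n i = cor (m n) (b n i) (T (e (m n) (b n i)))" for n i
  have t: "norm (inverse (t n i)) \<le> 2" if "i \<le> n" for n i
    using le_imp_inverse_le[OF diag[OF that]] by (simp add: t_def norm_inverse)
  obtain D where D: "D \<in> operators Y Y"
    and cor_D: "\<And>x n i. \<lbrakk>x \<in> carrier Y; i \<le> n\<rbrakk> \<Longrightarrow> cor n i (D x) = inverse (t n i) * cor n i x"
    using multiplier[where a = "\<lambda>n i. inverse (t n i)", OF t] by metis
  define V where "V = D \<circ> Q \<circ> T \<circ> R"
  have V: "V \<in> operators Y Y"
    unfolding V_def by (intro operators_comp D Q T R)
  define F where "F = identity_operator Y - V"
  have F: "F \<in> operators Y Y"
    unfolding F_def by (intro operators_diff identity_operator_mem V)
  have cor_V: "cor n i (V (e k j)) = inverse (t n i) * cor (m n) (b n i) (T (e (m k) (b k j)))"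
    if "i \<le> n" "j \<le> k" for n i k j
  proof -
    have "T (e (m k) (b k j)) \<in> carrier Y" "Q (T (e (m k) (b k j))) \<in> carrier Y"
      using that b(2) by (auto intro!: op_mem[OF Q] op_mem[OF T] e_mem)
    then show ?thesis
      using that by (simp add: V_def R_e cor_D cor_Q)
  qed
  have "norm (cor n i (F (e k j))) \<le> weight n * weight k / 2" if ij: "i \<le> n" "j \<le> k" for n i k j
  proof -
    have eq: "cor n i (F (e k j)) = cor n i (e k j) - cor n i (V (e k j))"
      unfolding F_def by (simp add: identity_operator_def e_mem ij op_diff[OF cor_op] op_mem[OF V])
    show ?thesis
    proof (cases "(n, i) = (k, j)")
      case True
      have "t n i \<noteq> 0"
        using diag[OF ij(1)] by (auto simp: t_def)
      then have "cor n i (F (e k j)) = 0"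
        unfolding eq using True ij by (simp add: cor_V cor_e t_def)
      then show ?thesis
        using less_imp_le[OF weight_pos[of k]] less_imp_le[OF weight_pos[of n]] by simp
    next
      case False
      have "norm (cor n i (F (e k j))) = norm (inverse (t n i)) * norm (cor (m n) (b n i) (T (e (m k) (b k j))))"
        using False ij by (auto simp: eq cor_V[OF ij] cor_e norm_mult)
      also have "\<dots> \<le> 2 * (weight n / 2 * (weight k / 2))"
        by (intro mult_mono t off ij False) auto
      finally show ?thesis by (simp add: mult.commute)
    qed
  qed
  then obtain G where G: "G \<in> operators Y Y" and eq: "G \<circ> (identity_operator Y - F) = identity_operator Y"
    using identity_minus_contraction_left_inverse[OF F nrm_le_of_small_matrix[OF F]] by blast
  have "identity_operator Y = (G \<circ> D \<circ> Q) \<circ> T \<circ> R"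
    using eq by (simp add: F_def V_def comp_assoc)
  then show ?thesis
    unfolding identity_factors_through_def using R operators_comp[OF operators_comp[OF G D] Q] by blast
qed

end

text \<open>
  The first alternative of \<open>block_summing\<close> bounds the rows of a matrix inside a block and holds for blocks
  with a maximum norm; the second bounds the columns and holds for blocks with a sum norm.
\<close>
locale sparse_block_basis = block_basis Y e cor
  for Y :: "('k::real_normed_field, 'v::ab_group_add) normed_space" and e cor +
  assumes weakly_null: "\<lbrakk>\<phi> \<in> operators Y scalar_space; 0 < \<epsilon>\<rbrakk> \<Longrightarrow>
      \<exists>N. \<forall>n\<ge>N. \<forall>i\<le>n. norm (\<phi> (e n i)) < \<epsilon>"
    and block_summing: "(\<forall>\<phi> C n. \<phi> \<in> operators Y scalar_space \<longrightarrow>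
        (\<forall>x\<in>carrier Y. norm (\<phi> x) \<le> C * nrm Y x) \<longrightarrow> (\<Sum>i\<le>n. norm (\<phi> (e n i))) \<le> C) \<or>
      (\<forall>x n. x \<in> carrier Y \<longrightarrow> (\<Sum>i\<le>n. norm (cor n i x)) \<le> nrm Y x)"
begin

lemma card_large_le:
  fixes f :: "nat \<Rightarrow> 'k"
  assumes "(\<Sum>i\<le>n. norm (f i)) \<le> C" "0 < \<epsilon>"
  shows "card {i. i \<le> n \<and> \<epsilon> \<le> norm (f i)} \<le> nat \<lceil>C / \<epsilon>\<rceil>"
proof -
  have "real (card {i. i \<le> n \<and> \<epsilon> \<le> norm (f i)}) * \<epsilon> \<le> (\<Sum>i | i \<le> n \<and> \<epsilon> \<le> norm (f i). norm (f i))"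
    by (rule sum_bounded_below) simp
  also have "\<dots> \<le> (\<Sum>i\<le>n. norm (f i))"
    by (rule sum_mono2) auto
  also have "\<dots> \<le> C" by fact
  finally have "real (card {i. i \<le> n \<and> \<epsilon> \<le> norm (f i)}) \<le> C / \<epsilon>"
    using assms(2) by (simp add: pos_le_divide_eq)
  then show ?thesis by linarith
qed

text \<open>
  The off-diagonal entries of \<open>T\<close> and of \<open>I - T\<close> have equal moduli, so a choice of
  coordinates that makes one of them nearly diagonal does so for the other; the alternative on the diagonal decides
  through which of the two the identity factors.
\<close>
theorem identity_factors_dichotomy:
  assumes T: "T \<in> operators Y Y"
  shows "identity_factors_through Y T \<or> identity_factors_through Y (identity_operator Y - T)"
proof -
  define t where "t n i k j = cor n i (T (e k j))" for n i k j
  obtain C where C: "0 \<le> C" "\<And>x. x \<in> carrier Y \<Longrightarrow> nrm Y (T x) \<le> C * nrm Y x"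
    using op_bound[OF T] by blast
  have row: "\<exists>N. \<forall>k\<ge>N. \<forall>j\<le>k. norm (t n i k j) < \<epsilon>" if "i \<le> n" "0 < \<epsilon>" for n i \<epsilon>
    using weakly_null[OF operators_comp[OF cor_op[OF that(1)] T] that(2)] by (simp add: t_def)
  have col: "\<exists>N. \<forall>k\<ge>N. \<forall>j\<le>k. norm (t k j n i) < \<epsilon>" if "i \<le> n" "0 < \<epsilon>" for n i \<epsilon>
    using cor_tendsto_zero[OF op_mem[OF T e_mem[OF that(1)]] that(2)] by (simp add: t_def)
  have "\<exists>d. \<forall>n. (\<forall>i\<le>n. card {j. j \<le> n \<and> \<epsilon> \<le> norm (t n i n j)} \<le> d) \<or>
      (\<forall>j\<le>n. card {i. i \<le> n \<and> \<epsilon> \<le> norm (t n i n j)} \<le> d)" if "0 < \<epsilon>" for \<epsilon>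
    using block_summing
  proof
    assume A: "\<forall>\<phi> C n. \<phi> \<in> operators Y scalar_space \<longrightarrow>
        (\<forall>x\<in>carrier Y. norm (\<phi> x) \<le> C * nrm Y x) \<longrightarrow> (\<Sum>i\<le>n. norm (\<phi> (e n i))) \<le> C"
    have "card {j. j \<le> n \<and> \<epsilon> \<le> norm (t n i n j)} \<le> nat \<lceil>C / \<epsilon>\<rceil>" if i: "i \<le> n" for n i
    proof (rule card_large_le[OF _ \<open>0 < \<epsilon>\<close>])
      have "norm ((cor n i \<circ> T) x) \<le> C * nrm Y x" if "x \<in> carrier Y" for x
        using order_trans[OF cor_le[OF i op_mem[OF T that]] C(2)[OF that]] by simp
      then have "(\<Sum>j\<le>n. norm ((cor n i \<circ> T) (e n j))) \<le> C"
        using A operators_comp[OF cor_op[OF i] T] by blast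
      then show "(\<Sum>j\<le>n. norm (t n i n j)) \<le> C"
        by (simp add: t_def)
    qed
    then show ?thesis by blast
  next
    assume B: "\<forall>x n. x \<in> carrier Y \<longrightarrow> (\<Sum>i\<le>n. norm (cor n i x)) \<le> nrm Y x"
    have "card {i. i \<le> n \<and> \<epsilon> \<le> norm (t n i n j)} \<le> nat \<lceil>C / \<epsilon>\<rceil>" if j: "j \<le> n" for n j
    proof (rule card_large_le[OF _ \<open>0 < \<epsilon>\<close>])
      have "(\<Sum>i\<le>n. norm (t n i n j)) \<le> nrm Y (T (e n j))"
        using B op_mem[OF T e_mem[OF j]] by (simp add: t_def)
      also have "\<dots> \<le> C * nrm Y (e n j)"
        by (rule C(2)[OF e_mem[OF j]])
      also have "\<dots> \<le> C"
        using mult_left_mono[OF nrm_e[OF j] C(1)] by simp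
      finally show "(\<Sum>i\<le>n. norm (t n i n j)) \<le> C" .
    qed
    then show ?thesis by blast
  qed
  note block = this
  have w: "0 < weight n / 2" "antimono (\<lambda>n. weight n / 2)" for n
    using weight_pos[of n] antimono_weight by (auto simp: antimono_def divide_right_mono)
  obtain m b where m: "strict_mono (m :: nat \<Rightarrow> nat)"
    and b: "\<And>n. inj_on (b n) {..n}" "\<And>n i. i \<le> n \<Longrightarrow> b n i \<le> m n"
    and off: "\<And>n i k j. \<lbrakk>i \<le> n; j \<le> k; (n, i) \<noteq> (k, j)\<rbrakk> \<Longrightarrow>
      norm (t (m n) (b n i) (m k) (b k j)) \<le> weight n / 2 * (weight k / 2)"
    and diag: "(\<forall>n. \<forall>i\<le>n. 1/2 \<le> norm (t (m n) (b n i) (m n) (b n i))) \<or>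
      (\<forall>n. \<forall>i\<le>n. 1/2 \<le> norm (1 - t (m n) (b n i) (m n) (b n i)))"
    by (rule select_nearly_diagonal[OF row col block w]) (assumption | blast)+
  from diag show ?thesis
  proof
    assume "\<forall>n. \<forall>i\<le>n. 1/2 \<le> norm (t (m n) (b n i) (m n) (b n i))"
    then have "identity_factors_through Y T"
      using off by (intro identity_factors_through_of_nearly_diagonal[OF T m b]) (auto simp: t_def)
    then show ?thesis ..
  next
    assume diag: "\<forall>n. \<forall>i\<le>n. 1/2 \<le> norm (1 - t (m n) (b n i) (m n) (b n i))"
    let ?S = "identity_operator Y - T"
    have S: "?S \<in> operators Y Y"
      by (intro operators_diff identity_operator_mem T)
    have cor_S: "cor (m n) (b n i) (?S (e (m k) (b k j))) =
        (if (n, i) = (k, j) then 1 else 0) - t (m n) (b n i) (m k) (b k j)"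
      if ij: "i \<le> n" "j \<le> k" for n i k j
    proof -
      have "m n = m k \<longleftrightarrow> n = k"
        using m by (simp add: strict_mono_eq)
      moreover have "b n i = b n j \<longleftrightarrow> i = j" if "n = k"
        using b(1)[of n] ij that by (auto simp: inj_on_def)
      ultimately show ?thesis
        using ij b(2) by (auto simp: t_def identity_operator_def e_mem op_diff[OF cor_op] op_mem[OF T] cor_e)
    qed
    have "identity_factors_through Y ?S"
    proof (rule identity_factors_through_of_nearly_diagonal[OF S m b])
      fix n i k j :: nat assume ij: "i \<le> n" "j \<le> k" "(n, i) \<noteq> (k, j)"
      show "norm (cor (m n) (b n i) (?S (e (m k) (b k j)))) \<le> weight n / 2 * (weight k / 2)"
        unfolding cor_S[OF ij(1,2)] if_not_P[OF ij(3)] using off[OF ij] by simp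
    next
      fix n i :: nat assume i: "i \<le> n"
      show "1/2 \<le> norm (cor (m n) (b n i) (?S (e (m n) (b n i))))"
        unfolding cor_S[OF i i] using diag i by simp
    qed
    then show ?thesis ..
  qed
qed

theorem unique_maximal_ideal: "unique_maximal_ideal (M_set Y) (operator_algebra Y)"
  by (rule unique_maximal_ideal_M_set[OF nontrivial identity_factors_dichotomy])

end

section \<open>Functionals on tails of a basis\<close>

lemma unimodular_rotation:
  fixes a :: "'k::real_normed_field"
  shows "\<exists>u. norm u = 1 \<and> u * a = of_real (norm a)"
proof (cases "a = 0")
  case False
  then show ?thesis
    by (intro exI[of _ "of_real (norm a) / a"]) (simp add: norm_divide)
qed (intro exI[of _ 1], simp)

text \<open>
  Suppose that \<open>\<phi>\<close> is bounded by \<open>C\<close> on the finitely supported part of the unit ball of some tail.  Then it is bounded by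
  \<open>\<theta>/2 C\<close> on a later tail: otherwise there are a vector \<open>x\<close> in the first tail and a vector \<open>y\<close> beyond the
  support of \<open>x\<close>, rotated such that \<open>\<phi> x\<close> and \<open>\<phi> y\<close> are positive, with \<open>\<phi> (x + y) > \<theta> C\<close>,
  although \<open>x + y\<close> lies in the first tail and has norm at most \<open>\<theta>\<close>.  As \<open>\<theta>/2 < 1\<close>, iteration gives
  arbitrarily small bounds.
\<close>
lemma (in normed_vspace) functional_small_on_tails:
  fixes P :: "nat \<Rightarrow> 'v \<Rightarrow> 'v"
  assumes P: "\<And>N. P N \<in> operators Y Y"
    and PP: "\<And>N M x. x \<in> carrier Y \<Longrightarrow> P N (P M x) = P (min N M) x"
    and \<theta>: "0 < \<theta>" "\<theta> < 2"
    and join: "\<And>M x y. \<lbrakk>x \<in> carrier Y; y \<in> carrier Y; nrm Y x \<le> 1; nrm Y y \<le> 1; P M x = x; P M y = 0\<rbrakk> \<Longrightarrow>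
      nrm Y (x + y) \<le> \<theta>"
    and \<phi>: "\<phi> \<in> operators Y scalar_space" and "0 < \<epsilon>"
  shows "\<exists>N. \<forall>x\<in>carrier Y. nrm Y x \<le> 1 \<longrightarrow> P N x = 0 \<longrightarrow> (\<exists>M. P M x = x) \<longrightarrow> norm (\<phi> x) < \<epsilon>"
proof -
  define S where "S N = {x \<in> carrier Y. nrm Y x \<le> 1 \<and> P N x = 0 \<and> (\<exists>M. P M x = x)}" for N
  have P_later: "P M x = x" if "P L x = x" "L \<le> M" "x \<in> carrier Y" for L M x
    using PP[OF that(3), of M L] that by (simp add: min_absorb2)
  have P_earlier: "P L x = 0" if "P M x = 0" "L \<le> M" "x \<in> carrier Y" for L M x
    using PP[OF that(3), of L M] that by (simp add: min_absorb1 op_zero[OF P])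
  have rotate: "scl Y u x \<in> S N" if "x \<in> S N" "norm u = 1" for u x N
    using that unfolding S_def
    by (auto simp: scl_mem nrm_scl op_scl[OF P] scl_zero_right) metis
  have step: "\<exists>M. \<forall>x\<in>S M. norm (\<phi> x) \<le> \<theta> / 2 * C" if C: "\<forall>x\<in>S N. norm (\<phi> x) \<le> C" for N C
  proof (rule ccontr)
    assume no: "\<not> ?thesis"
    have large: "\<exists>x\<in>S M. \<theta> / 2 * C < norm (\<phi> x) \<and> \<phi> x = of_real (norm (\<phi> x))" for M
    proof -
      obtain x where x: "x \<in> S M" "\<theta> / 2 * C < norm (\<phi> x)"
        using no by (force simp: not_le)
      obtain u where u: "norm u = 1" "u * \<phi> x = of_real (norm (\<phi> x))"
        using unimodular_rotation by blast
      have "\<phi> (scl Y u x) = of_real (norm (\<phi> x))"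
        using x u(2) op_scl[OF \<phi>, of x u] by (simp add: S_def)
      then show ?thesis
        using rotate[OF x(1) u(1)] x(2) by (intro bexI[of _ "scl Y u x"]) simp_all
    qed
    obtain x where x: "x \<in> S N" "\<theta> / 2 * C < norm (\<phi> x)" "\<phi> x = of_real (norm (\<phi> x))"
      using large by blast
    then obtain M0 where M0: "P M0 x = x" by (auto simp: S_def)
    define M where "M = max M0 N"
    obtain y where y: "y \<in> S M" "\<theta> / 2 * C < norm (\<phi> y)" "\<phi> y = of_real (norm (\<phi> y))"
      using large by blast
    then obtain M1 where M1: "P M1 y = y" by (auto simp: S_def)
    have mem: "x \<in> carrier Y" "y \<in> carrier Y"
      using x y by (auto simp: S_def)
    define z where "z = scl Y (of_real (1 / \<theta>)) (x + y)"
    have "nrm Y (x + y) \<le> \<theta>"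
    proof (rule join[where M = M])
      show "P M x = x" by (rule P_later[OF M0 _ mem(1)]) (simp add: M_def)
    qed (use x y mem in \<open>simp_all add: S_def\<close>)
    then have "nrm Y z \<le> 1"
      using \<theta>(1) mem by (simp add: z_def nrm_scl add_mem norm_divide)
    moreover have "P N y = 0"
      by (rule P_earlier[of M]) (use y mem in \<open>simp_all add: S_def M_def\<close>)
    then have "P N z = 0"
      using x mem by (simp add: z_def op_scl[OF P] op_add[OF P] add_mem S_def scl_zero_right)
    moreover have "P (max M0 M1) x = x" "P (max M0 M1) y = y"
      using P_later[OF M0 _ mem(1)] P_later[OF M1 _ mem(2)] by simp_all
    then have "P (max M0 M1) z = z"
      using mem by (simp add: z_def op_scl[OF P] op_add[OF P] add_mem)
    ultimately have "z \<in> S N"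
      using mem by (auto simp: S_def z_def scl_mem add_mem)
    moreover have "\<phi> z = of_real ((norm (\<phi> x) + norm (\<phi> y)) / \<theta>)"
    proof -
      have "\<phi> z = of_real (1 / \<theta>) * (\<phi> x + \<phi> y)"
        using mem by (simp add: z_def op_scl[OF \<phi>] op_add[OF \<phi>] add_mem)
      also have "\<dots> = of_real (1 / \<theta>) * (of_real (norm (\<phi> x)) + of_real (norm (\<phi> y)))"
        using x(3) y(3) by simp
      finally show ?thesis by simp
    qed
    then have "norm (\<phi> z) = (norm (\<phi> x) + norm (\<phi> y)) / \<theta>"
      using \<theta>(1) by (simp only: norm_of_real) simp
    moreover have "C < (norm (\<phi> x) + norm (\<phi> y)) / \<theta>"
      using x(2) y(2) \<theta>(1) by (simp add: pos_less_divide_eq mult.commute)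
    ultimately show False
      using C by force
  qed
  obtain C where C: "\<And>x. x \<in> carrier Y \<Longrightarrow> norm (\<phi> x) \<le> C * nrm Y x" "0 \<le> C"
    using op_bound[OF \<phi>] by auto
  have "norm (\<phi> x) \<le> C" if "x \<in> S 0" for x
    using C(1)[of x] mult_left_mono[of "nrm Y x" 1 C] C(2) that by (auto simp: S_def)
  then have iterate: "\<exists>N. \<forall>x\<in>S N. norm (\<phi> x) \<le> (\<theta> / 2) ^ k * C" for k
  proof (induction k)
    case (Suc k)
    then obtain N where "\<forall>x\<in>S N. norm (\<phi> x) \<le> (\<theta> / 2) ^ k * C" by auto
    from step[OF this] show ?case by (simp add: mult.assoc)
  qed auto
  have "(\<lambda>k. (\<theta> / 2) ^ k * C) \<longlonglongrightarrow> 0 * C"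
    using \<theta> by (intro tendsto_mult_right LIMSEQ_power_zero) simp
  then have "\<forall>\<^sub>F k in sequentially. (\<theta> / 2) ^ k * C < \<epsilon>"
    using \<open>0 < \<epsilon>\<close> by (intro order_tendstoD(2)) auto
  then obtain k where "(\<theta> / 2) ^ k * C < \<epsilon>"
    by (auto simp: eventually_sequentially)
  moreover obtain N where "\<forall>x\<in>S N. norm (\<phi> x) \<le> (\<theta> / 2) ^ k * C"
    using iterate by blast
  ultimately have "\<forall>x\<in>S N. norm (\<phi> x) < \<epsilon>"
    by force
  then show ?thesis
    unfolding S_def by blast
qed

text \<open>
  Conditions on a space that yield the interface above both for it and for its dual.  \<open>join_le\<close> makes tails
  small for functionals on the space; \<open>split_le\<close> is the dual inequality, and it becomes \<open>join_le\<close> for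
  functionals.  \<open>signs_le\<close> bounds the norm on a block by the maximum norm; dually, functionals are absolutely
  summable over a block.
\<close>
locale strict_block_basis = block_basis Y e cor
  for Y :: "('k::real_normed_field, 'v::ab_group_add) normed_space" and e cor +
  fixes \<theta> :: real
  assumes \<theta>: "0 < \<theta>" "\<theta> < 2"
    and initial_proj_le: "x \<in> carrier Y \<Longrightarrow> nrm Y (initial_proj N x) \<le> nrm Y x"
    and tail_le: "x \<in> carrier Y \<Longrightarrow> nrm Y (x - initial_proj N x) \<le> nrm Y x"
    and join_le: "\<lbrakk>x \<in> carrier Y; y \<in> carrier Y; nrm Y x \<le> 1; nrm Y y \<le> 1;
      initial_proj N x = x; initial_proj N y = 0\<rbrakk> \<Longrightarrow> nrm Y (x + y) \<le> \<theta>"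
    and split_le: "x \<in> carrier Y \<Longrightarrow>
      nrm Y (initial_proj N x) + nrm Y (x - initial_proj N x) \<le> \<theta> * nrm Y x"
    and signs_le: "(\<And>i. i \<le> n \<Longrightarrow> norm (c i) \<le> 1) \<Longrightarrow> nrm Y (\<Sum>i\<le>n. scl Y (c i) (e n i)) \<le> 1"
begin

lemma functional_small_on_finite_tails:
  assumes "\<phi> \<in> operators Y scalar_space" "0 < \<epsilon>"
  shows "\<exists>N. \<forall>x\<in>carrier Y. nrm Y x \<le> 1 \<longrightarrow> initial_proj N x = 0 \<longrightarrow>
    (\<exists>M. initial_proj M x = x) \<longrightarrow> norm (\<phi> x) < \<epsilon>"
  by (rule functional_small_on_tails[OF initial_proj_op initial_proj_initial_proj \<theta> join_le assms])

text \<open>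
  This is the norm convergence of the coordinate expansion of a functional, hence the density of finitely
  supported functionals in the dual.
\<close>
lemma shrinking:
  assumes \<phi>: "\<phi> \<in> operators Y scalar_space" and "0 < \<epsilon>"
  shows "\<exists>N0. \<forall>N\<ge>N0. \<forall>x\<in>carrier Y. nrm Y x \<le> 1 \<longrightarrow> norm (\<phi> (x - initial_proj N x)) \<le> \<epsilon>"
proof -
  obtain N0 where N0: "\<And>x. \<lbrakk>x \<in> carrier Y; nrm Y x \<le> 1; initial_proj N0 x = 0; \<exists>M. initial_proj M x = x\<rbrakk> \<Longrightarrow>
      norm (\<phi> x) < \<epsilon>"
    using functional_small_on_finite_tails[OF assms] by metis
  have "norm (\<phi> (x - initial_proj N x)) \<le> \<epsilon>" if x: "x \<in> carrier Y" "nrm Y x \<le> 1" and N: "N0 \<le> N" for x N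
  proof -
    define y where "y = x - initial_proj N x"
    have y: "y \<in> carrier Y" "nrm Y y \<le> 1"
      using x tail_le[OF x(1), of N] by (simp_all add: y_def diff_mem initial_proj_mem)
    have y0: "initial_proj N0 y = 0"
      using x N by (simp add: y_def op_diff[OF initial_proj_op] initial_proj_mem initial_proj_initial_proj)
    have "norm (\<phi> (initial_proj M y)) \<le> \<epsilon>" for M
    proof (rule less_imp_le, rule N0)
      show "nrm Y (initial_proj M y) \<le> 1"
        using initial_proj_le[OF y(1), of M] y(2) by simp
      have "initial_proj N0 (initial_proj M y) = initial_proj M (initial_proj N0 y)"
        by (simp add: initial_proj_initial_proj y min.commute)
      then show "initial_proj N0 (initial_proj M y) = 0"
        by (simp add: y0 op_zero[OF initial_proj_op])
      show "\<exists>L. initial_proj L (initial_proj M y) = initial_proj M y"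
        by (intro exI[of _ M]) (simp add: initial_proj_initial_proj y)
    qed (rule initial_proj_mem)
    moreover have "(\<lambda>M. \<phi> (initial_proj M y)) \<longlonglongrightarrow> \<phi> y"
      using op_limit[OF \<phi> initial_proj_mem y(1) initial_proj_tendsto[OF y(1)]]
      by (simp add: LIM_zero_iff tendsto_norm_zero_iff)
    ultimately show ?thesis
      using LIMSEQ_le_const2[OF tendsto_norm[of "\<lambda>M. \<phi> (initial_proj M y)"]] by (auto simp: y_def)
  qed
  then show ?thesis by blast
qed

lemma sum_norm_block_le:
  assumes \<phi>: "\<phi> \<in> operators Y scalar_space" and C: "\<And>x. x \<in> carrier Y \<Longrightarrow> norm (\<phi> x) \<le> C * nrm Y x"
  shows "(\<Sum>i\<le>n. norm (\<phi> (e n i))) \<le> C"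
proof -
  have "\<forall>i. \<exists>u. norm u = 1 \<and> u * \<phi> (e n i) = of_real (norm (\<phi> (e n i)))"
    using unimodular_rotation by blast
  then obtain u where u: "\<And>i. norm (u i) = 1" "\<And>i. u i * \<phi> (e n i) = of_real (norm (\<phi> (e n i)))"
    by metis
  have "1 \<le> nrm Y (e n 0)"
    using cor_le[of 0 n "e n 0"] cor_e[of 0 n 0 n] by (simp add: e_mem)
  then have "0 \<le> C"
    using order_trans[OF norm_ge_zero C[OF e_mem[of 0 n]]] by (simp add: zero_le_mult_iff)
  define x where "x = (\<Sum>i\<le>n. scl Y (u i) (e n i))"
  have x: "x \<in> carrier Y" "nrm Y x \<le> 1"
    unfolding x_def by (auto intro!: sum_mem coord_mem signs_le simp: u)
  have "\<phi> x = (\<Sum>i\<le>n. of_real (norm (\<phi> (e n i))))"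
    unfolding x_def
    by (subst op_sum[OF \<phi>]) (auto simp: coord_mem op_scl[OF \<phi>] e_mem u)
  also have "\<dots> = of_real (\<Sum>i\<le>n. norm (\<phi> (e n i)))"
    by simp
  finally have "norm (\<phi> x) = \<bar>\<Sum>i\<le>n. norm (\<phi> (e n i))\<bar>"
    by (simp only: norm_of_real)
  then have "(\<Sum>i\<le>n. norm (\<phi> (e n i))) \<le> C * nrm Y x"
    using C[OF x(1)] by simp
  also have "\<dots> \<le> C * 1"
    by (rule mult_left_mono[OF x(2) \<open>0 \<le> C\<close>])
  finally show ?thesis by simp
qed

lemma sparse: "sparse_block_basis Y e cor"
proof
  fix \<phi> and \<epsilon> :: real assume "\<phi> \<in> operators Y scalar_space" "0 < \<epsilon>"
  from functional_small_on_finite_tails[OF this] obtain N where N: "\<And>x. \<lbrakk>x \<in> carrier Y; nrm Y x \<le> 1;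
      initial_proj N x = 0; \<exists>M. initial_proj M x = x\<rbrakk> \<Longrightarrow> norm (\<phi> x) < \<epsilon>"
    by metis
  have "norm (\<phi> (e n i)) < \<epsilon>" if "N \<le> n" "i \<le> n" for n i
    using that by (intro N exI[of _ "Suc n"]) (simp_all add: e_mem nrm_e initial_proj_e)
  then show "\<exists>N. \<forall>n\<ge>N. \<forall>i\<le>n. norm (\<phi> (e n i)) < \<epsilon>"
    by blast
qed (use sum_norm_block_le in blast)

lemma eq_of_cor:
  assumes x: "x \<in> carrier Y" and y: "y \<in> carrier Y" and eq: "\<And>n i. i \<le> n \<Longrightarrow> cor n i x = cor n i y"
  shows "x = y"
proof -
  have P: "initial_proj N x = initial_proj N y" for N
    by (rule initial_proj_eq_of_cor[OF x y]) (rule eq)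
  have "nrm Y (x - y) \<le> 0"
  proof (rule LIMSEQ_le_const)
    show "(\<lambda>N. nrm Y (initial_proj N x - x) + nrm Y (initial_proj N y - y)) \<longlonglongrightarrow> 0"
      using tendsto_add[OF initial_proj_tendsto[OF x] initial_proj_tendsto[OF y]] by simp
    have "nrm Y (x - y) \<le> nrm Y (initial_proj N x - x) + nrm Y (initial_proj N y - y)" for N
      using nrm_diff_triangle[OF x initial_proj_mem y, of N x] nrm_minus_commute[OF x initial_proj_mem[of N x]]
      by (simp add: P)
    then show "\<exists>M. \<forall>N\<ge>M. nrm Y (x - y) \<le> nrm Y (initial_proj N x - x) + nrm Y (initial_proj N y - y)"
      by blast
  qed
  then have "x - y = 0"
    using nrm_nonneg[OF diff_mem[OF x y]] by (intro nrm_eq_0 diff_mem x y) simp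
  then show ?thesis by simp
qed

end

section \<open>Dual spaces\<close>

lemma dual_space_simps [simp]:
  "carrier (dual_space X) = operators X scalar_space"
  "scl (dual_space X) = (\<lambda>c f x. c * f x)"
  "nrm (dual_space X) = operator_norm X scalar_space"
  by (simp_all add: dual_space_def)

text \<open>
  Like the operators above, the adjoint vanishes outside its domain, here the dual space.
\<close>
definition adjoint ::
  "('k::real_normed_field, 'v::ab_group_add) normed_space \<Rightarrow> ('v \<Rightarrow> 'v) \<Rightarrow> ('v \<Rightarrow> 'k) \<Rightarrow> 'v \<Rightarrow> 'k" where
  "adjoint X T f = (if f \<in> operators X scalar_space then f \<circ> T else 0)"

context normed_vspace
begin

lemma functional_bdd_above:
  assumes "f \<in> operators Y scalar_space"
  shows "bdd_above ((\<lambda>x. norm (f x)) ` {x \<in> carrier Y. nrm Y x \<le> 1})"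
proof -
  obtain C where C: "0 \<le> C" "\<And>x. x \<in> carrier Y \<Longrightarrow> norm (f x) \<le> C * nrm Y x"
    using op_bound[OF assms] by auto
  show ?thesis
  proof (rule bdd_aboveI2)
    fix x assume "x \<in> {x \<in> carrier Y. nrm Y x \<le> 1}"
    then show "norm (f x) \<le> C"
      using C(2)[of x] mult_left_mono[of "nrm Y x" 1 C] C(1) by simp
  qed
qed

lemma operator_norm_leI:
  assumes "\<And>x. \<lbrakk>x \<in> carrier Y; nrm Y x \<le> 1\<rbrakk> \<Longrightarrow> norm (f x) \<le> C"
  shows "operator_norm Y scalar_space f \<le> C"
  unfolding operator_norm_def
proof (rule cSUP_least)
  have "0 \<in> {x \<in> carrier Y. nrm Y x \<le> 1}"
    by (simp add: zero_mem nrm_zero)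
  then show "{x \<in> carrier Y. nrm Y x \<le> 1} \<noteq> {}"
    by blast
qed (use assms in simp)

lemma functional_le:
  assumes f: "f \<in> operators Y scalar_space" and x: "x \<in> carrier Y"
  shows "norm (f x) \<le> operator_norm Y scalar_space f * nrm Y x"
proof (cases "nrm Y x = 0")
  case True
  then show ?thesis
    using nrm_eq_0[OF x] by (simp add: op_zero[OF f])
next
  case False
  then have pos: "0 < nrm Y x"
    using nrm_nonneg[OF x] by simp
  define y where "y = scl Y (of_real (inverse (nrm Y x))) x"
  have y: "y \<in> carrier Y" "nrm Y y \<le> 1"
    using pos x by (simp_all add: y_def scl_mem nrm_scl norm_inverse)
  have "norm (f y) \<le> operator_norm Y scalar_space f"
    unfolding operator_norm_def using cSUP_upper[OF _ functional_bdd_above[OF f], of y] y by simp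
  moreover have "norm (f y) = norm (f x) / nrm Y x"
    using pos x by (simp add: y_def op_scl[OF f] norm_mult norm_inverse divide_inverse mult.commute)
  ultimately show ?thesis
    using pos by (simp add: pos_divide_le_eq)
qed

lemma functional_le_unit:
  assumes f: "f \<in> operators Y scalar_space" and x: "x \<in> carrier Y" "nrm Y x \<le> 1"
  shows "norm (f x) \<le> operator_norm Y scalar_space f"
  unfolding operator_norm_def using cSUP_upper[OF _ functional_bdd_above[OF f], of x] x by simp

lemma operator_norm_nonneg: "f \<in> operators Y scalar_space \<Longrightarrow> 0 \<le> operator_norm Y scalar_space f"
  using functional_le_unit[of f 0] by (simp add: zero_mem nrm_zero op_zero)

lemma operators_scalar_scl: "f \<in> operators Y scalar_space \<Longrightarrow> (\<lambda>x. c * f x) \<in> operators Y scalar_space"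
  using normed_vspace.operators_scl[OF normed_vspace_scalar, of f Y c] by simp

lemma operator_norm_scl:
  assumes f: "f \<in> operators Y scalar_space"
  shows "operator_norm Y scalar_space (\<lambda>x. c * f x) = norm c * operator_norm Y scalar_space f"
proof (rule antisym)
  show "operator_norm Y scalar_space (\<lambda>x. c * f x) \<le> norm c * operator_norm Y scalar_space f"
    by (rule operator_norm_leI) (simp add: norm_mult mult_left_mono functional_le_unit[OF f])
  show "norm c * operator_norm Y scalar_space f \<le> operator_norm Y scalar_space (\<lambda>x. c * f x)"
  proof (cases "c = 0")
    case True
    then show ?thesis
      using operator_norm_nonneg[OF operators_scalar_scl[OF f, of c]] by simp
  next
    case False
    have "operator_norm Y scalar_space f \<le> operator_norm Y scalar_space (\<lambda>x. c * f x) / norm c"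
    proof (rule operator_norm_leI)
      fix x assume "x \<in> carrier Y" "nrm Y x \<le> 1"
      from functional_le_unit[OF operators_scalar_scl[OF f, of c] this]
      show "norm (f x) \<le> operator_norm Y scalar_space (\<lambda>x. c * f x) / norm c"
        using False by (simp add: norm_mult pos_le_divide_eq mult.commute)
    qed
    then show ?thesis
      using False by (simp add: pos_le_divide_eq mult.commute)
  qed
qed

lemma normed_vspace_dual: "normed_vspace (dual_space Y)"
proof
  fix f g :: "'v \<Rightarrow> 'k"
  assume f: "f \<in> carrier (dual_space Y)" and g: "g \<in> carrier (dual_space Y)"
  show "f + g \<in> carrier (dual_space Y)"
    using normed_vspace.operators_add[OF normed_vspace_scalar] f g by simp
  have "operator_norm Y scalar_space (f + g) \<le> operator_norm Y scalar_space f + operator_norm Y scalar_space g"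
  proof (rule operator_norm_leI)
    fix x assume "x \<in> carrier Y" "nrm Y x \<le> 1"
    then show "norm ((f + g) x) \<le> operator_norm Y scalar_space f + operator_norm Y scalar_space g"
      using norm_triangle_ineq[of "f x" "g x"] functional_le_unit[of f x] functional_le_unit[of g x] f g by simp
  qed
  then show "nrm (dual_space Y) (f + g) \<le> nrm (dual_space Y) f + nrm (dual_space Y) g"
    by simp
next
  fix f :: "'v \<Rightarrow> 'k" assume f: "f \<in> carrier (dual_space Y)" "nrm (dual_space Y) f = 0"
  show "f = 0"
  proof
    fix x show "f x = 0 x"
      using functional_le[of f x] f op_outside[of f Y scalar_space x] by (cases "x \<in> carrier Y") auto
  qed
qed (auto simp: normed_vspace.zero_operator[OF normed_vspace_scalar] operators_scalar_scl
    operator_norm_scl algebra_simps)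

lemma adjoint_op:
  assumes T: "T \<in> operators Y Y"
  shows "adjoint Y T \<in> operators (dual_space Y) (dual_space Y)"
proof -
  obtain C where C: "0 \<le> C" "\<And>x. x \<in> carrier Y \<Longrightarrow> nrm Y (T x) \<le> C * nrm Y x"
    using op_bound[OF T] by blast
  interpret D: normed_vspace "dual_space Y" by (rule normed_vspace_dual)
  show ?thesis
  proof (rule operatorsI[where C = C])
    fix f assume f: "f \<in> carrier (dual_space Y)"
    then show "adjoint Y T f \<in> carrier (dual_space Y)"
      by (simp add: adjoint_def operators_comp T)
    have "operator_norm Y scalar_space (f \<circ> T) \<le> C * operator_norm Y scalar_space f"
    proof (rule operator_norm_leI)
      fix x assume x: "x \<in> carrier Y" "nrm Y x \<le> 1"
      have "norm (f (T x)) \<le> operator_norm Y scalar_space f * nrm Y (T x)"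
        using f by (intro functional_le op_mem[OF T] x) simp
      also have "\<dots> \<le> operator_norm Y scalar_space f * (C * nrm Y x)"
        using f by (intro mult_left_mono C x operator_norm_nonneg) simp
      also have "\<dots> \<le> operator_norm Y scalar_space f * (C * 1)"
        using f by (intro mult_left_mono C x operator_norm_nonneg) simp
      finally show "norm ((f \<circ> T) x) \<le> C * operator_norm Y scalar_space f"
        by (simp add: mult.commute)
    qed
    then show "nrm (dual_space Y) (adjoint Y T f) \<le> C * nrm (dual_space Y) f"
      using f by (simp add: adjoint_def)
    fix c
    show "adjoint Y T (scl (dual_space Y) c f) = scl (dual_space Y) c (adjoint Y T f)"
      using f D.scl_mem[OF f, of c] by (simp add: adjoint_def fun_eq_iff)
  next
    fix f g assume f: "f \<in> carrier (dual_space Y)" and g: "g \<in> carrier (dual_space Y)"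
    then show "adjoint Y T (f + g) = adjoint Y T f + adjoint Y T g"
      using D.add_mem[OF f g] by (simp add: adjoint_def fun_eq_iff)
  qed (simp add: adjoint_def)
qed

end

text \<open>
  A Cauchy sequence of functionals converges pointwise; letting one index tend to infinity in Cauchy's
  condition turns this into convergence in norm.
\<close>
lemma complete_dual:
  fixes Y :: "('k::{real_normed_field, banach}, 'v::ab_group_add) normed_space"
  assumes "normed_vspace Y"
  shows "complete_normed_vspace (dual_space Y)"
proof -
  interpret normed_vspace Y by fact
  interpret D: normed_vspace "dual_space Y" by (rule normed_vspace_dual)
  let ?N = "operator_norm Y scalar_space"
  show ?thesis
  proof
    fix s :: "nat \<Rightarrow> 'v \<Rightarrow> 'k"
    assume "\<And>k. s k \<in> carrier (dual_space Y)"
      and "\<And>\<epsilon>. 0 < \<epsilon> \<Longrightarrow> \<exists>K. \<forall>j\<ge>K. \<forall>k\<ge>K. nrm (dual_space Y) (s j - s k) < \<epsilon>"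
    then have s: "s k \<in> operators Y scalar_space"
      and cau: "0 < \<epsilon> \<Longrightarrow> \<exists>K. \<forall>j\<ge>K. \<forall>k\<ge>K. ?N (s j - s k) < \<epsilon>" for k \<epsilon>
      by simp_all
    have s_diff: "s j - s k \<in> operators Y scalar_space" for j k
      using D.diff_mem[of "s j" "s k"] s by simp
    have "Cauchy (\<lambda>k. s k x)" if x: "x \<in> carrier Y" for x
    proof (rule metric_CauchyI)
      fix \<epsilon> :: real assume "0 < \<epsilon>"
      define \<delta> where "\<delta> = \<epsilon> / (nrm Y x + 1)"
      have pos: "0 < nrm Y x + 1" using nrm_nonneg[OF x] by simp
      then have "0 < \<delta>" using \<open>0 < \<epsilon>\<close> by (simp add: \<delta>_def)
      then obtain K where K: "\<forall>j\<ge>K. \<forall>k\<ge>K. ?N (s j - s k) < \<delta>"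
        using cau by blast
      have "dist (s j x) (s k x) < \<epsilon>" if "K \<le> j" "K \<le> k" for j k
      proof -
        have "dist (s j x) (s k x) \<le> ?N (s j - s k) * nrm Y x"
          using functional_le[OF s_diff[of j k] x] by (simp add: dist_norm)
        also have "\<dots> \<le> \<delta> * nrm Y x"
          using K that nrm_nonneg[OF x] by (intro mult_right_mono) (auto intro: less_imp_le)
        also have "\<dots> < \<delta> * (nrm Y x + 1)"
          using \<open>0 < \<delta>\<close> by simp
        also have "\<dots> = \<epsilon>"
          using pos by (simp add: \<delta>_def)
        finally show ?thesis .
      qed
      then show "\<exists>M. \<forall>m\<ge>M. \<forall>n\<ge>M. dist (s m x) (s n x) < \<epsilon>"
        by blast
    qed
    then have conv: "convergent (\<lambda>k. s k x)" if "x \<in> carrier Y" for x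
      using that by (simp add: Cauchy_convergent_iff)
    define g where "g x = lim (\<lambda>k. s k x)" for x
    have lim: "(\<lambda>k. s k x) \<longlonglongrightarrow> g x" for x
    proof (cases "x \<in> carrier Y")
      case True
      then show ?thesis using conv by (simp add: g_def convergent_LIMSEQ_iff)
    next
      case False
      then have "(\<lambda>k. s k x) = (\<lambda>k. 0)" by (simp add: op_outside[OF s])
      then show ?thesis by (simp add: g_def)
    qed
    have close: "norm (s k x - g x) \<le> \<epsilon> * nrm Y x"
      if "\<forall>j\<ge>K. \<forall>k\<ge>K. ?N (s j - s k) < \<epsilon>" "K \<le> k" and x: "x \<in> carrier Y" for k K x \<epsilon>
    proof (rule LIMSEQ_le_const2)
      show "(\<lambda>j. norm (s k x - s j x)) \<longlonglongrightarrow> norm (s k x - g x)"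
        by (intro tendsto_intros lim)
      have "norm (s k x - s j x) \<le> \<epsilon> * nrm Y x" if "K \<le> j" for j
      proof -
        have "norm (s k x - s j x) \<le> ?N (s k - s j) * nrm Y x"
          using functional_le[OF s_diff[of k j] x] by simp
        also have "\<dots> \<le> \<epsilon> * nrm Y x"
          using that \<open>\<forall>j\<ge>K. \<forall>k\<ge>K. ?N (s j - s k) < \<epsilon>\<close> \<open>K \<le> k\<close> nrm_nonneg[OF x]
          by (intro mult_right_mono) (auto intro: less_imp_le)
        finally show ?thesis .
      qed
      then show "\<exists>N. \<forall>j\<ge>N. norm (s k x - s j x) \<le> \<epsilon> * nrm Y x"
        by blast
    qed
    obtain K1 where K1: "\<forall>j\<ge>K1. \<forall>k\<ge>K1. ?N (s j - s k) < 1"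
      using cau[of 1] by auto
    have g: "g \<in> operators Y scalar_space"
    proof (rule operatorsI[where C = "?N (s K1) + 1"])
      fix x y assume x: "x \<in> carrier Y" and y: "y \<in> carrier Y"
      have "(\<lambda>k. s k (x + y)) \<longlonglongrightarrow> g x + g y"
        using tendsto_add[OF lim[of x] lim[of y]] by (simp add: op_add[OF s] x y)
      then show "g (x + y) = g x + g y"
        using LIMSEQ_unique lim by blast
    next
      fix c x assume x: "x \<in> carrier Y"
      have "(\<lambda>k. s k (scl Y c x)) \<longlonglongrightarrow> c * g x"
        using tendsto_mult_left[OF lim[of x], of c] by (simp add: op_scl[OF s] x)
      then show "g (scl Y c x) = scl scalar_space c (g x)"
        using LIMSEQ_unique lim by auto
    next
      fix x assume x: "x \<in> carrier Y"
      have "norm (g x) \<le> norm (s K1 x) + norm (s K1 x - g x)"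
        using norm_triangle_ineq4[of "s K1 x" "s K1 x - g x"] by simp
      also have "\<dots> \<le> ?N (s K1) * nrm Y x + 1 * nrm Y x"
        by (intro add_mono functional_le s x close[OF K1]) simp
      finally show "nrm scalar_space (g x) \<le> (?N (s K1) + 1) * nrm Y x"
        by (simp add: algebra_simps)
    next
      fix x assume x: "x \<notin> carrier Y"
      have "(\<lambda>k. s k x) = (\<lambda>k. 0)" by (simp add: op_outside[OF s] x)
      then show "g x = 0"
        using LIMSEQ_unique[OF lim[of x]] by simp
    qed simp
    have "(\<lambda>k. ?N (s k - g)) \<longlonglongrightarrow> 0"
    proof (rule LIMSEQ_I)
      fix \<epsilon> :: real assume "0 < \<epsilon>"
      then obtain K where K: "\<forall>j\<ge>K. \<forall>k\<ge>K. ?N (s j - s k) < \<epsilon> / 2"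
        using cau[of "\<epsilon> / 2"] by auto
      have "norm (?N (s k - g) - 0) < \<epsilon>" if "K \<le> k" for k
      proof -
        have "s k - g \<in> operators Y scalar_space"
          using D.diff_mem[of "s k" g] s g by simp
        then have "0 \<le> ?N (s k - g)" by (rule operator_norm_nonneg)
        moreover have "?N (s k - g) \<le> \<epsilon> / 2"
        proof (rule operator_norm_leI)
          fix x assume x: "x \<in> carrier Y" "nrm Y x \<le> 1"
          have "norm ((s k - g) x) \<le> \<epsilon> / 2 * nrm Y x"
            using close[OF K that x(1)] by simp
          also have "\<dots> \<le> \<epsilon> / 2 * 1"
            using x(2) \<open>0 < \<epsilon>\<close> by (intro mult_left_mono) auto
          finally show "norm ((s k - g) x) \<le> \<epsilon> / 2" by simp
        qed
        ultimately show ?thesis using \<open>0 < \<epsilon>\<close> by simp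
      qed
      then show "\<exists>K. \<forall>k\<ge>K. norm (?N (s k - g) - 0) < \<epsilon>"
        by blast
    qed
    then show "\<exists>g\<in>carrier (dual_space Y). (\<lambda>k. nrm (dual_space Y) (s k - g)) \<longlonglongrightarrow> 0"
      using g by auto
  qed
qed

text \<open>
  The canonical image of a vector in the bidual.
\<close>
definition evaluation ::
  "('k::real_normed_field, 'v::ab_group_add) normed_space \<Rightarrow> 'v \<Rightarrow> ('v \<Rightarrow> 'k) \<Rightarrow> 'k" where
  "evaluation X x f = (if f \<in> operators X scalar_space then f x else 0)"

lemma sum_fun_apply: "(\<Sum>a\<in>A. f a) x = (\<Sum>a\<in>A. f a x)"
  for f :: "'a \<Rightarrow> 'b \<Rightarrow> 'c::comm_monoid_add"
  by (induction A rule: infinite_finite_induct) simp_all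

text \<open>
  The unit vectors of the dual are the coordinate functionals, and its coordinates are the evaluations at
  the unit vectors; the initial projections, the multipliers and the embeddings are adjoints of
  those of the space, with the roles of \<open>R\<close> and \<open>Q\<close> exchanged.
\<close>
theorem sparse_block_basis_dual:
  fixes Y :: "('k::{real_normed_field, banach}, 'v::ab_group_add) normed_space"
  assumes "strict_block_basis Y e cor \<theta>"
  shows "sparse_block_basis (dual_space Y) cor (\<lambda>n i. evaluation Y (e n i))"
proof -
  interpret strict_block_basis Y e cor \<theta> by fact
  let ?D = "dual_space Y" and ?N = "operator_norm Y scalar_space"
  interpret D: complete_normed_vspace ?D
    by (rule complete_dual) (rule normed_vspace_axioms)
  interpret D: block_system ?D cor "\<lambda>n i. evaluation Y (e n i)"
  proof
    fix n i :: nat assume i: "i \<le> n"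
    show "cor n i \<in> carrier ?D"
      using cor_op[OF i] by simp
    show "nrm ?D (cor n i) \<le> 1"
      using cor_le[OF i] by (auto intro!: operator_norm_leI intro: order_trans)
    have le: "norm (evaluation Y (e n i) f) \<le> ?N f" if "f \<in> operators Y scalar_space" for f
      using functional_le_unit[OF that e_mem[OF i] nrm_e[OF i]] that by (simp add: evaluation_def)
    show "evaluation Y (e n i) \<in> operators ?D scalar_space"
    proof (rule operatorsI[where C = 1])
      fix f g assume "f \<in> carrier ?D" "g \<in> carrier ?D"
      then show "evaluation Y (e n i) (f + g) = evaluation Y (e n i) f + evaluation Y (e n i) g"
        using D.add_mem[of f g] by (simp add: evaluation_def)
    next
      fix c f assume "f \<in> carrier ?D"
      then show "evaluation Y (e n i) (scl ?D c f) = scl scalar_space c (evaluation Y (e n i) f)"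
        using D.scl_mem[of f c] by (simp add: evaluation_def)
    qed (use le in \<open>simp_all add: evaluation_def\<close>)
    show "norm (evaluation Y (e n i) f) \<le> nrm ?D f" if "f \<in> carrier ?D" for f
      using le that by simp
    fix m j :: nat assume j: "j \<le> m"
    show "evaluation Y (e n i) (cor m j) = (if n = m \<and> i = j then 1 else 0)"
      using cor_e[OF j i] cor_op[OF j] by (auto simp: evaluation_def)
  qed
  have proj: "D.initial_proj N f = f \<circ> initial_proj N" if f: "f \<in> operators Y scalar_space" for f N
  proof
    fix x
    show "D.initial_proj N f x = (f \<circ> initial_proj N) x"
    proof (cases "x \<in> carrier Y")
      case True
      have "D.initial_proj N f x = (\<Sum>n<N. \<Sum>i\<le>n. f (e n i) * cor n i x)"
        using f by (simp add: D.initial_proj_def sum_fun_apply evaluation_def)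
      also have "\<dots> = f (initial_proj N x)"
        using op_initial_proj[OF f True] by (simp add: mult.commute)
      finally show ?thesis by simp
    next
      case False
      have "D.initial_proj N f \<in> operators Y scalar_space"
        using D.initial_proj_mem[of N f] by simp
      then show ?thesis
        using False by (simp add: op_outside initial_proj_def op_zero[OF f])
    qed
  qed
  interpret D: block_basis ?D cor "\<lambda>n i. evaluation Y (e n i)"
  proof
    fix f assume "f \<in> carrier ?D"
    then have f: "f \<in> operators Y scalar_space" by simp
    show "(\<lambda>N. nrm ?D (D.initial_proj N f - f)) \<longlonglongrightarrow> 0"
    proof (rule LIMSEQ_I)
      fix \<epsilon> :: real assume "0 < \<epsilon>"
      then obtain N0 where N0: "\<forall>N\<ge>N0. \<forall>x\<in>carrier Y. nrm Y x \<le> 1 \<longrightarrow> norm (f (x - initial_proj N x)) \<le> \<epsilon> / 2"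
        using shrinking[OF f, of "\<epsilon> / 2"] by auto
      have "norm (nrm ?D (D.initial_proj N f - f) - 0) < \<epsilon>" if "N0 \<le> N" for N
      proof -
        have "?N (D.initial_proj N f - f) \<le> \<epsilon> / 2"
        proof (rule operator_norm_leI)
          fix x assume x: "x \<in> carrier Y" "nrm Y x \<le> 1"
          have "(D.initial_proj N f - f) x = - f (x - initial_proj N x)"
            by (simp add: proj[OF f] op_diff[OF f] x initial_proj_mem)
          then show "norm ((D.initial_proj N f - f) x) \<le> \<epsilon> / 2"
            using N0 that x by simp
        qed
        moreover have "0 \<le> nrm ?D (D.initial_proj N f - f)"
          by (intro D.nrm_nonneg D.diff_mem D.initial_proj_mem) (simp add: f)
        ultimately show ?thesis
          using \<open>0 < \<epsilon>\<close> by simp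
      qed
      then show "\<exists>N0. \<forall>N\<ge>N0. norm (nrm ?D (D.initial_proj N f - f) - 0) < \<epsilon>"
        by blast
    qed
  next
    fix a :: "nat \<Rightarrow> nat \<Rightarrow> 'k" and K assume a: "\<And>n i. i \<le> n \<Longrightarrow> norm (a n i) \<le> K"
    obtain A where A: "A \<in> operators Y Y"
      and cor_A: "\<And>x n i. \<lbrakk>x \<in> carrier Y; i \<le> n\<rbrakk> \<Longrightarrow> cor n i (A x) = a n i * cor n i x"
      using multiplier[where a = a, OF a] by metis
    have A_e: "A (e n i) = scl Y (a n i) (e n i)" if "i \<le> n" for n i
      using that by (intro eq_of_cor)
        (auto simp: op_mem[OF A] e_mem coord_mem cor_A cor_scl cor_e)
    show "\<exists>B\<in>operators ?D ?D. \<forall>f\<in>carrier ?D. \<forall>n. \<forall>i\<le>n.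
        evaluation Y (e n i) (B f) = a n i * evaluation Y (e n i) f"
    proof (intro bexI[OF _ adjoint_op[OF A]] ballI allI impI)
      fix f and n i :: nat assume f: "f \<in> carrier ?D" and i: "i \<le> n"
      then have "f \<in> operators Y scalar_space" "f \<circ> A \<in> operators Y scalar_space"
        by (simp_all add: operators_comp A)
      then show "evaluation Y (e n i) (adjoint Y A f) = a n i * evaluation Y (e n i) f"
        using i by (simp add: evaluation_def adjoint_def A_e op_scl e_mem)
    qed
  next
    fix m :: "nat \<Rightarrow> nat" and b assume mb: "strict_mono m" "\<And>n. inj_on (b n) {..n}" "\<And>n i. i \<le> n \<Longrightarrow> b n i \<le> m n"
    obtain R Q where R: "R \<in> operators Y Y" and Q: "Q \<in> operators Y Y"
      and R_e: "\<And>n i. i \<le> n \<Longrightarrow> R (e n i) = e (m n) (b n i)"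
      and cor_Q: "\<And>x n i. \<lbrakk>x \<in> carrier Y; i \<le> n\<rbrakk> \<Longrightarrow> cor n i (Q x) = cor (m n) (b n i) x"
      using spread[OF mb] by metis
    show "\<exists>R\<in>operators ?D ?D. \<exists>Q\<in>operators ?D ?D. (\<forall>n. \<forall>i\<le>n. R (cor n i) = cor (m n) (b n i)) \<and>
        (\<forall>f\<in>carrier ?D. \<forall>n. \<forall>i\<le>n. evaluation Y (e n i) (Q f) = evaluation Y (e (m n) (b n i)) f)"
    proof (rule bexI[OF _ adjoint_op[OF Q]], rule bexI[OF _ adjoint_op[OF R]], intro conjI ballI allI impI)
      fix n i :: nat assume i: "i \<le> n"
      show "adjoint Y Q (cor n i) = cor (m n) (b n i)"
      proof
        fix x show "adjoint Y Q (cor n i) x = cor (m n) (b n i) x"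
          using i mb(3)[OF i]
          by (cases "x \<in> carrier Y")
            (simp_all add: adjoint_def cor_op cor_Q op_outside[OF Q] op_outside[OF cor_op] cor_zero)
      qed
      fix f assume "f \<in> carrier ?D"
      then have "f \<in> operators Y scalar_space" "f \<circ> R \<in> operators Y scalar_space"
        by (simp_all add: operators_comp R)
      then show "evaluation Y (e n i) (adjoint Y R f) = evaluation Y (e (m n) (b n i)) f"
        using i by (simp add: evaluation_def adjoint_def R_e)
    qed
  qed
  show ?thesis
  proof
    fix \<phi> and \<epsilon> :: real assume "\<phi> \<in> operators ?D scalar_space" "0 < \<epsilon>"
    have join: "nrm ?D (f + g) \<le> \<theta>"
      if mem: "f \<in> carrier ?D" "g \<in> carrier ?D" and le: "nrm ?D f \<le> 1" "nrm ?D g \<le> 1"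
        and P: "D.initial_proj M f = f" "D.initial_proj M g = 0" for M f g
    proof -
      have f: "f \<in> operators Y scalar_space" and g: "g \<in> operators Y scalar_space"
        using mem by simp_all
      have "?N (f + g) \<le> \<theta>"
      proof (rule operator_norm_leI)
        fix x assume x: "x \<in> carrier Y" "nrm Y x \<le> 1"
        have Px: "initial_proj M x \<in> carrier Y" and tx: "x - initial_proj M x \<in> carrier Y"
          by (intro initial_proj_mem diff_mem x)+
        have fx: "f x = f (initial_proj M x)"
          using fun_cong[OF P(1), of x] by (simp add: proj[OF f])
        have "g (initial_proj M x) = 0"
          using fun_cong[OF P(2), of x] by (simp add: proj[OF g])
        then have gx: "g x = g (x - initial_proj M x)"
          by (simp add: op_diff[OF g] x Px)
        have "norm ((f + g) x) \<le> norm (f (initial_proj M x)) + norm (g (x - initial_proj M x))"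
          using norm_triangle_ineq[of "f x" "g x"] by (simp add: fx[symmetric] gx[symmetric])
        also have "\<dots> \<le> ?N f * nrm Y (initial_proj M x) + ?N g * nrm Y (x - initial_proj M x)"
          by (intro add_mono functional_le f g Px tx)
        also have "\<dots> \<le> 1 * nrm Y (initial_proj M x) + 1 * nrm Y (x - initial_proj M x)"
          using le by (intro add_mono mult_right_mono nrm_nonneg Px tx) auto
        also have "\<dots> \<le> \<theta> * nrm Y x"
          using split_le[OF x(1), of M] by simp
        also have "\<dots> \<le> \<theta> * 1"
          using \<theta>(1) x(2) by (intro mult_left_mono) auto
        finally show "norm ((f + g) x) \<le> \<theta>" by simp
      qed
      then show ?thesis by simp
    qed
    have "\<exists>N. \<forall>f\<in>carrier ?D. nrm ?D f \<le> 1 \<longrightarrow> D.initial_proj N f = 0 \<longrightarrow>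
        (\<exists>M. D.initial_proj M f = f) \<longrightarrow> norm (\<phi> f) < \<epsilon>"
      by (rule D.functional_small_on_tails[OF D.initial_proj_op D.initial_proj_initial_proj \<theta> join
          \<open>\<phi> \<in> operators ?D scalar_space\<close> \<open>0 < \<epsilon>\<close>])
    then obtain N where N: "\<And>f. \<lbrakk>f \<in> carrier ?D; nrm ?D f \<le> 1; D.initial_proj N f = 0; \<exists>M. D.initial_proj M f = f\<rbrakk> \<Longrightarrow>
        norm (\<phi> f) < \<epsilon>"
      by blast
    have "norm (\<phi> (cor n i)) < \<epsilon>" if "N \<le> n" "i \<le> n" for n i
    proof (rule N)
      show "D.initial_proj N (cor n i) = 0" "\<exists>M. D.initial_proj M (cor n i) = cor n i"
        using that by (auto simp only: D.initial_proj_e split: if_splits intro!: exI[of _ "Suc n"])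
    qed (intro D.e_mem D.nrm_e that(2))+
    then show "\<exists>N. \<forall>n\<ge>N. \<forall>i\<le>n. norm (\<phi> (cor n i)) < \<epsilon>"
      by blast
  next
    have "(\<Sum>i\<le>n. norm (evaluation Y (e n i) f)) \<le> nrm ?D f" if "f \<in> carrier ?D" for f n
      using sum_norm_block_le[of f "?N f"] functional_le[of f] that by (simp add: evaluation_def)
    then show "(\<forall>\<phi> C n. \<phi> \<in> operators ?D scalar_space \<longrightarrow>
        (\<forall>x\<in>carrier ?D. norm (\<phi> x) \<le> C * nrm ?D x) \<longrightarrow> (\<Sum>i\<le>n. norm (\<phi> (cor n i))) \<le> C) \<or>
      (\<forall>f n. f \<in> carrier ?D \<longrightarrow> (\<Sum>i\<le>n. norm (evaluation Y (e n i) f)) \<le> nrm ?D f)"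
      by (intro disjI2 allI impI)
  qed
qed

section \<open>The space \<open>W\<^sub>p\<close>\<close>

text \<open>
  Convexity of \<open>x \<mapsto> x powr p\<close> on the open half-line, extended to its end point \<open>0\<close>, where vanishing blocks
  lie.
\<close>
lemma powr_convex_combination:
  fixes p t u v :: real
  assumes p: "1 \<le> p" and t: "0 \<le> t" "t \<le> 1" and u: "0 \<le> u" and v: "0 \<le> v"
  shows "(t * u + (1 - t) * v) powr p \<le> t * u powr p + (1 - t) * v powr p"
proof -
  have shrink: "(s * w) powr p \<le> s * w powr p" if "0 \<le> s" "s \<le> 1" "0 \<le> w" for s w :: real
  proof -
    have "s powr p \<le> s powr 1"
      using that p by (intro powr_mono') auto
    then show ?thesis
      using that by (simp add: powr_mult mult_right_mono)
  qed
  consider "u = 0" | "v = 0" | "0 < u" "0 < v"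
    using u v by linarith
  then show ?thesis
  proof cases
    case 1
    then show ?thesis using shrink[of "1 - t" v] t v p by simp
  next
    case 2
    then show ?thesis using shrink[of t u] t u p by simp
  next
    case 3
    then show ?thesis
      using convex_onD[OF powr_convex[OF p], of "1 - t" u v] t by simp
  qed
qed

definition block_norm :: "nat \<Rightarrow> (nat \<Rightarrow> 'k::real_normed_field) \<Rightarrow> real" where
  "block_norm n v = Max ((\<lambda>i. norm (v i)) ` {..<Suc n})"

lemma block_norm_le_iff: "block_norm n v \<le> r \<longleftrightarrow> (\<forall>i\<le>n. norm (v i) \<le> r)"
  unfolding block_norm_def by (subst Max_le_iff) (auto simp: less_Suc_eq_le)

lemma norm_le_block_norm: "i \<le> n \<Longrightarrow> norm (v i) \<le> block_norm n v"
  using block_norm_le_iff[of n v "block_norm n v"] by simp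

lemma block_norm_nonneg: "0 \<le> block_norm n v"
  using norm_le_block_norm[of 0 n v] by (meson norm_ge_zero order_trans zero_le)

lemma block_norm_zero: "block_norm n 0 = 0"
  by (intro antisym block_norm_nonneg) (simp add: block_norm_le_iff)

lemma block_norm_add_le: "block_norm n (v + w) \<le> block_norm n v + block_norm n w"
  unfolding block_norm_le_iff
  by (auto intro!: order_trans[OF norm_triangle_ineq] add_mono norm_le_block_norm)

lemma block_norm_mult_le:
  assumes "\<And>i. i \<le> n \<Longrightarrow> norm (a i) \<le> C"
  shows "block_norm n (\<lambda>i. a i * v i) \<le> C * block_norm n v"
proof -
  have "0 \<le> C"
    by (rule order_trans[OF norm_ge_zero assms[of 0]]) simp
  then show ?thesis
    unfolding block_norm_le_iff
    by (auto simp: norm_mult intro!: mult_mono assms norm_le_block_norm)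
qed

lemma block_norm_Suc: "block_norm (Suc n) v = max (norm (v (Suc n))) (block_norm n v)"
  unfolding block_norm_def by (subst lessThan_Suc) (simp add: lessThan_empty_iff)

lemma tendsto_block_norm:
  assumes "\<And>i. i \<le> n \<Longrightarrow> (\<lambda>k. v k i) \<longlonglongrightarrow> w i"
  shows "(\<lambda>k. block_norm n (v k)) \<longlonglongrightarrow> block_norm n w"
  using assms
proof (induction n)
  case 0
  then show ?case by (simp add: block_norm_def lessThan_Suc tendsto_norm)
next
  case (Suc n)
  then show ?case
    unfolding block_norm_Suc by (intro tendsto_max tendsto_norm) auto
qed

context
  fixes p :: real and K :: "'k::{real_normed_field, banach} itself"
  assumes p: "1 < p"
begin

abbreviation W :: "('k, nat \<Rightarrow> nat \<Rightarrow> 'k) normed_space" where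
  "W \<equiv> W_space K p"

definition triangular :: "(nat \<Rightarrow> nat \<Rightarrow> 'k) \<Rightarrow> bool" where
  "triangular x \<longleftrightarrow> (\<forall>n. \<forall>i>n. x n i = 0)"

lemma scl_W: "scl W c x = (\<lambda>n i. c * x n i)"
  by (simp add: W_space_def lp_sum_def linf_def)

lemma mem_W: "x \<in> carrier W \<longleftrightarrow> triangular x \<and> summable (\<lambda>n. block_norm n (x n) powr p)"
  by (auto simp: W_space_def lp_sum_def linf_def block_norm_def triangular_def Suc_le_eq)

lemma nrm_W: "nrm W x = (\<Sum>n. block_norm n (x n) powr p) powr (1 / p)"
  by (simp add: W_space_def lp_sum_def linf_def block_norm_def)

lemma nrm_W_nonneg: "0 \<le> nrm W x"
  by (simp add: nrm_W)

lemma powr_p_root: "0 \<le> r \<Longrightarrow> (r powr p) powr (1 / p) = r"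
  using p by (simp add: powr_powr)

lemma powr_p_mono: "\<lbrakk>0 \<le> r; r \<le> s\<rbrakk> \<Longrightarrow> r powr p \<le> s powr p"
  using p by (intro powr_mono2) auto

lemma le_of_powr_p_le: "\<lbrakk>0 \<le> r; 0 \<le> s; r powr p \<le> s powr p\<rbrakk> \<Longrightarrow> r \<le> s"
  using powr_mono2[of "1 / p" "r powr p" "s powr p"] p by (simp add: powr_p_root)

lemma nrm_W_powr: "x \<in> carrier W \<Longrightarrow> nrm W x powr p = (\<Sum>n. block_norm n (x n) powr p)"
  using p by (simp add: nrm_W powr_powr suminf_nonneg mem_W)

lemma finite_sum_le_nrm_W:
  assumes "x \<in> carrier W" "finite A"
  shows "(\<Sum>n\<in>A. block_norm n (x n) powr p) \<le> nrm W x powr p"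
  unfolding nrm_W_powr[OF assms(1)] using assms by (intro sum_le_suminf) (auto simp: mem_W)

lemma W_leI:
  assumes "triangular x" "0 \<le> r" "\<And>N. (\<Sum>n<N. block_norm n (x n) powr p) \<le> r powr p"
  shows "x \<in> carrier W" and "nrm W x \<le> r"
proof -
  have summ: "summable (\<lambda>n. block_norm n (x n) powr p)"
    by (rule summableI_nonneg_bounded[OF _ assms(3)]) simp
  then show mem: "x \<in> carrier W"
    using assms(1) by (simp add: mem_W)
  have "nrm W x powr p \<le> r powr p"
    unfolding nrm_W_powr[OF mem] by (rule suminf_le_const[OF summ assms(3)])
  then show "nrm W x \<le> r"
    by (rule le_of_powr_p_le[OF nrm_W_nonneg assms(2)])
qed

text \<open>
  If each block of \<open>y\<close> is controlled by a block of \<open>x\<close>, and no block of \<open>x\<close> is used twice, then the norm of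
  \<open>y\<close> is controlled.  This is the source of all operators on the space: truncations, multiplications and
  the embeddings that move blocks.
\<close>
lemma W_dominated:
  assumes x: "x \<in> carrier W" and y: "triangular y" and \<mu>: "inj_on \<mu> A" and C: "0 \<le> C"
    and dom: "\<And>n. n \<in> A \<Longrightarrow> block_norm n (y n) \<le> C * block_norm (\<mu> n) (x (\<mu> n))"
    and zero: "\<And>n. n \<notin> A \<Longrightarrow> y n = 0"
  shows "y \<in> carrier W" and "nrm W y \<le> C * nrm W x"
proof -
  have fin: "(\<Sum>n<N. block_norm n (y n) powr p) \<le> (C * nrm W x) powr p" for N
  proof -
    have "(\<Sum>n<N. block_norm n (y n) powr p) = (\<Sum>n\<in>{..<N} \<inter> A. block_norm n (y n) powr p)"
      using zero p by (intro sum.mono_neutral_right) (auto simp: block_norm_zero)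
    also have "\<dots> \<le> (\<Sum>n\<in>{..<N} \<inter> A. (C * block_norm (\<mu> n) (x (\<mu> n))) powr p)"
      by (intro sum_mono powr_p_mono dom block_norm_nonneg) simp
    also have "\<dots> = C powr p * (\<Sum>n\<in>{..<N} \<inter> A. block_norm (\<mu> n) (x (\<mu> n)) powr p)"
      using C by (simp add: powr_mult block_norm_nonneg sum_distrib_left)
    also have "(\<Sum>n\<in>{..<N} \<inter> A. block_norm (\<mu> n) (x (\<mu> n)) powr p) =
        (\<Sum>n\<in>\<mu> ` ({..<N} \<inter> A). block_norm n (x n) powr p)"
      by (subst sum.reindex) (auto intro: inj_on_subset[OF \<mu>])
    also have "C powr p * \<dots> \<le> C powr p * nrm W x powr p"
      by (intro mult_left_mono finite_sum_le_nrm_W x) auto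
    also have "\<dots> = (C * nrm W x) powr p"
      using C nrm_W_nonneg by (simp add: powr_mult)
    finally show ?thesis .
  qed
  have nonneg: "0 \<le> C * nrm W x"
    using C nrm_W_nonneg by simp
  show "y \<in> carrier W"
    by (rule W_leI(1)[OF y nonneg fin])
  show "nrm W y \<le> C * nrm W x"
    by (rule W_leI(2)[OF y nonneg fin])
qed

lemma W_single_block:
  assumes "triangular x" "\<And>k. k \<noteq> n \<Longrightarrow> x k = 0" "block_norm n (x n) \<le> r"
  shows "x \<in> carrier W" and "nrm W x \<le> r"
proof -
  have r: "0 \<le> r"
    by (rule order_trans[OF block_norm_nonneg assms(3)])
  have fin: "(\<Sum>k<N. block_norm k (x k) powr p) \<le> r powr p" for N
  proof -
    have "(\<Sum>k<N. block_norm k (x k) powr p) \<le> (\<Sum>k<N. if k = n then r powr p else 0)"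
    proof (rule sum_mono)
      fix k
      show "block_norm k (x k) powr p \<le> (if k = n then r powr p else 0)"
        using powr_p_mono[OF block_norm_nonneg assms(3)] assms(2)[of k] p
        by (cases "k = n") (simp_all add: block_norm_zero)
    qed
    also have "\<dots> \<le> r powr p" by simp
    finally show ?thesis .
  qed
  show "x \<in> carrier W"
    by (rule W_leI(1)[OF assms(1) r fin])
  show "nrm W x \<le> r"
    by (rule W_leI(2)[OF assms(1) r fin])
qed

lemma block_norm_le_nrm_W:
  assumes "x \<in> carrier W"
  shows "block_norm n (x n) \<le> nrm W x"
  using finite_sum_le_nrm_W[OF assms, of "{n}"]
  by (intro le_of_powr_p_le[OF block_norm_nonneg nrm_W_nonneg]) simp

lemma norm_coordinate_le_nrm_W: "\<lbrakk>x \<in> carrier W; i \<le> n\<rbrakk> \<Longrightarrow> norm (x n i) \<le> nrm W x"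
  by (rule order_trans[OF norm_le_block_norm block_norm_le_nrm_W])

lemma W_zero: "0 \<in> carrier W" "nrm W 0 = 0"
proof -
  have "triangular 0"
    by (simp add: triangular_def)
  note zero = W_single_block[of 0 0 0, OF this]
  show "0 \<in> carrier W"
    by (rule zero(1)) (simp_all add: block_norm_zero)
  have "nrm W 0 \<le> 0"
    by (rule zero(2)) (simp_all add: block_norm_zero)
  then show "nrm W 0 = 0"
    using nrm_W_nonneg by (rule antisym)
qed

lemma nrm_W_eq_0:
  assumes "x \<in> carrier W" "nrm W x = 0"
  shows "x = 0"
proof (intro ext)
  fix n i
  show "x n i = 0 n i"
    using norm_coordinate_le_nrm_W[OF assms(1), of i n] assms by (cases "i \<le> n") (auto simp: mem_W triangular_def)
qed

text \<open>
  Minkowski's inequality: with \<open>a = \<parallel>x\<parallel>\<close> and \<open>b = \<parallel>y\<parallel>\<close>, the vector \<open>(x + y) / (a + b)\<close> is a convex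
  combination of \<open>x / a\<close> and \<open>y / b\<close>, to which convexity applies in each block.
\<close>
lemma W_triangle:
  assumes x: "x \<in> carrier W" and y: "y \<in> carrier W"
  shows "x + y \<in> carrier W" and "nrm W (x + y) \<le> nrm W x + nrm W y"
proof -
  define a b where "a = nrm W x" and "b = nrm W y"
  have ab: "0 \<le> a" "0 \<le> b"
    by (simp_all add: a_def b_def nrm_W_nonneg)
  have "x + y \<in> carrier W \<and> nrm W (x + y) \<le> a + b"
  proof (cases "a = 0 \<or> b = 0")
    case True
    then have "x = 0 \<or> y = 0"
      using nrm_W_eq_0 x y by (auto simp: a_def b_def)
    then show ?thesis
      using x y by (auto simp: a_def b_def W_zero)
  next
    case False
    then have pos: "0 < a" "0 < b" using ab by auto
    define t where "t = a / (a + b)"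
    have t: "0 \<le> t" "t \<le> 1" "1 - t = b / (a + b)" "0 < a + b"
      using pos by (auto simp: t_def field_simps)
    have tri: "triangular (x + y)"
      using x y by (simp add: mem_W triangular_def)
    have "(\<Sum>n<N. block_norm n ((x + y) n) powr p) \<le> (a + b) powr p" for N
    proof -
      have "(\<Sum>n<N. block_norm n ((x + y) n) powr p) \<le>
          (\<Sum>n<N. (a + b) powr p * (t * (block_norm n (x n) powr p / a powr p) +
            (1 - t) * (block_norm n (y n) powr p / b powr p)))"
      proof (rule sum_mono)
        fix n
        let ?u = "block_norm n (x n)" and ?v = "block_norm n (y n)"
        have "?u + ?v = (a + b) * (t * (?u / a) + (1 - t) * (?v / b))"
          unfolding t(3) using pos by (simp add: t_def distrib_left)
        then have "block_norm n ((x + y) n) \<le> (a + b) * (t * (?u / a) + (1 - t) * (?v / b))"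
          using block_norm_add_le[of n "x n" "y n"] by simp
        then have "block_norm n ((x + y) n) powr p \<le> ((a + b) * (t * (?u / a) + (1 - t) * (?v / b))) powr p"
          by (intro powr_p_mono block_norm_nonneg)
        also have "\<dots> = (a + b) powr p * (t * (?u / a) + (1 - t) * (?v / b)) powr p"
          using t pos by (intro powr_mult) 
        also have "\<dots> \<le> (a + b) powr p * (t * (?u / a) powr p + (1 - t) * (?v / b) powr p)"
          using t pos p by (intro mult_left_mono powr_convex_combination) (auto simp: block_norm_nonneg)
        finally show "block_norm n ((x + y) n) powr p \<le>
            (a + b) powr p * (t * (?u powr p / a powr p) + (1 - t) * (?v powr p / b powr p))"
          using pos by (simp add: powr_divide block_norm_nonneg)
      qed
      also have "\<dots> = (a + b) powr p * (t * ((\<Sum>n<N. block_norm n (x n) powr p) / a powr p) +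
          (1 - t) * ((\<Sum>n<N. block_norm n (y n) powr p) / b powr p))"
        by (simp only: sum.distrib sum_distrib_left[symmetric] sum_divide_distrib[symmetric])
      also have "\<dots> \<le> (a + b) powr p * (t * 1 + (1 - t) * 1)"
      proof (intro mult_left_mono add_mono)
        show "(\<Sum>n<N. block_norm n (x n) powr p) / a powr p \<le> 1"
          using finite_sum_le_nrm_W[OF x, of "{..<N}"] pos by (simp add: a_def)
        show "(\<Sum>n<N. block_norm n (y n) powr p) / b powr p \<le> 1"
          using finite_sum_le_nrm_W[OF y, of "{..<N}"] pos by (simp add: b_def)
      qed (use t in auto)
      finally show ?thesis by simp
    qed
    then show ?thesis
      by (intro conjI W_leI[OF tri add_nonneg_nonneg[OF ab]])
  qed
  then show "x + y \<in> carrier W" "nrm W (x + y) \<le> nrm W x + nrm W y"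
    by (simp_all add: a_def b_def)
qed

lemma W_scl:
  assumes x: "x \<in> carrier W"
  shows "scl W c x \<in> carrier W" and "nrm W (scl W c x) \<le> norm c * nrm W x"
proof -
  have "triangular (scl W c x)"
    using x by (simp add: mem_W triangular_def scl_W)
  moreover have "block_norm n (scl W c x n) \<le> norm c * block_norm n (x n)" for n
    unfolding scl_W by (rule block_norm_mult_le) simp
  ultimately show "scl W c x \<in> carrier W" "nrm W (scl W c x) \<le> norm c * nrm W x"
    using W_dominated[OF x, of "scl W c x" "\<lambda>n. n" UNIV "norm c"] by simp_all
qed

lemma normed_vspace_W: "normed_vspace W"
proof
  fix x and c :: 'k assume x: "x \<in> carrier W"
  show "nrm W (scl W c x) = norm c * nrm W x"
  proof (cases "c = 0")
    case True
    then have "scl W c x = 0" by (simp add: scl_W fun_eq_iff)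
    then show ?thesis using True by (simp add: W_zero)
  next
    case False
    have "scl W (inverse c) (scl W c x) = x"
      using False by (simp add: scl_W mult.assoc[symmetric])
    then have "nrm W x \<le> norm (inverse c) * nrm W (scl W c x)"
      using W_scl(2)[OF W_scl(1)[OF x, of c], of "inverse c"] by simp
    then have "norm c * nrm W x \<le> nrm W (scl W c x)"
      using False by (simp add: norm_inverse norm_divide field_simps)
    then show ?thesis using W_scl(2)[OF x, of c] by simp
  qed
qed (use W_zero W_triangle W_scl nrm_W_eq_0 in \<open>auto simp: scl_W fun_eq_iff algebra_simps\<close>)

text \<open>
  The coordinates of a Cauchy sequence converge.  Finite partial sums of the norm are continuous in the
  coordinates, so Cauchy's condition passes to the limit.
\<close>
lemma complete_W: "complete_normed_vspace W"
proof -
  interpret normed_vspace W by (rule normed_vspace_W)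
  show ?thesis
  proof
    fix s :: "nat \<Rightarrow> nat \<Rightarrow> nat \<Rightarrow> 'k"
    assume s: "\<And>k. s k \<in> carrier W"
      and cau: "\<And>\<epsilon>. 0 < \<epsilon> \<Longrightarrow> \<exists>K. \<forall>j\<ge>K. \<forall>k\<ge>K. nrm W (s j - s k) < \<epsilon>"
    have s_diff: "s j - s k \<in> carrier W" for j k
      by (intro diff_mem s)
    define z where "z n i = lim (\<lambda>k. s k n i)" for n i
    have lim: "(\<lambda>k. s k n i) \<longlonglongrightarrow> z n i" for n i
    proof (cases "i \<le> n")
      case True
      have "Cauchy (\<lambda>k. s k n i)"
      proof (rule metric_CauchyI)
        fix \<epsilon> :: real assume "0 < \<epsilon>"
        then obtain K where K: "\<forall>j\<ge>K. \<forall>k\<ge>K. nrm W (s j - s k) < \<epsilon>"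
          using cau by blast
        have "dist (s j n i) (s k n i) < \<epsilon>" if "K \<le> j" "K \<le> k" for j k
          using norm_coordinate_le_nrm_W[OF s_diff[of j k] True] K that
          by (force simp: dist_norm)
        then show "\<exists>M. \<forall>j\<ge>M. \<forall>k\<ge>M. dist (s j n i) (s k n i) < \<epsilon>"
          by blast
      qed
      then show ?thesis
        by (simp add: z_def Cauchy_convergent_iff convergent_LIMSEQ_iff)
    next
      case False
      then have "(\<lambda>k. s k n i) = (\<lambda>k. 0)"
        using s by (simp add: mem_W triangular_def)
      then show ?thesis by (simp add: z_def)
    qed
    have tri: "triangular (s k - z)" for k
    proof -
      have "z n i = 0" if "n < i" for n i
      proof -
        have "(\<lambda>k. s k n i) = (\<lambda>k. 0)"
          using s that by (simp add: mem_W triangular_def)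
        then show ?thesis
          using LIMSEQ_unique[OF lim[of n i]] by simp
      qed
      then show ?thesis
        using s[of k] by (simp add: mem_W triangular_def)
    qed
    have close: "s k - z \<in> carrier W \<and> nrm W (s k - z) \<le> \<epsilon>"
      if "0 < \<epsilon>" and K: "\<forall>j\<ge>K. \<forall>k\<ge>K. nrm W (s j - s k) < \<epsilon>" and k: "K \<le> k" for \<epsilon> K k
    proof -
      have "(\<Sum>n<N. block_norm n ((s k - z) n) powr p) \<le> \<epsilon> powr p" for N
      proof (rule LIMSEQ_le_const2)
        show "(\<lambda>j. \<Sum>n<N. block_norm n ((s k - s j) n) powr p) \<longlonglongrightarrow> (\<Sum>n<N. block_norm n ((s k - z) n) powr p)"
          using p by (intro tendsto_sum tendsto_powr' tendsto_block_norm tendsto_const)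
            (auto simp: block_norm_nonneg intro!: tendsto_diff lim)
        have "(\<Sum>n<N. block_norm n ((s k - s j) n) powr p) \<le> \<epsilon> powr p" if j: "K \<le> j" for j
        proof -
          have "nrm W (s k - s j) \<le> \<epsilon>"
            using K j k by (auto intro: less_imp_le)
          then have "nrm W (s k - s j) powr p \<le> \<epsilon> powr p"
            by (rule powr_p_mono[OF nrm_W_nonneg])
          then show ?thesis
            using finite_sum_le_nrm_W[OF s_diff[of k j], of "{..<N}"] by simp
        qed
        then show "\<exists>J. \<forall>j\<ge>J. (\<Sum>n<N. block_norm n ((s k - s j) n) powr p) \<le> \<epsilon> powr p"
          by blast
      qed
      then show ?thesis
        by (intro conjI W_leI[OF tri less_imp_le[OF \<open>0 < \<epsilon>\<close>]])
    qed
    obtain K1 where "\<forall>j\<ge>K1. \<forall>k\<ge>K1. nrm W (s j - s k) < 1"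
      using cau[of 1] by auto
    then have "s K1 - z \<in> carrier W"
      using close[of 1 K1 K1] by simp
    then have "z \<in> carrier W"
      using diff_mem[OF s[of K1], of "s K1 - z"] by simp
    moreover have "(\<lambda>k. nrm W (s k - z)) \<longlonglongrightarrow> 0"
    proof (rule LIMSEQ_I)
      fix \<epsilon> :: real assume "0 < \<epsilon>"
      then obtain K where K: "\<forall>j\<ge>K. \<forall>k\<ge>K. nrm W (s j - s k) < \<epsilon> / 2"
        using cau[of "\<epsilon> / 2"] by auto
      have "norm (nrm W (s k - z) - 0) < \<epsilon>" if "K \<le> k" for k
        using close[OF _ K that] \<open>0 < \<epsilon>\<close> nrm_W_nonneg[of "s k - z"] by simp
      then show "\<exists>K. \<forall>k\<ge>K. norm (nrm W (s k - z) - 0) < \<epsilon>"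
        by blast
    qed
    ultimately show "\<exists>z\<in>carrier W. (\<lambda>k. nrm W (s k - z)) \<longlonglongrightarrow> 0"
      by blast
  qed
qed

definition unit_coord :: "nat \<Rightarrow> nat \<Rightarrow> nat \<Rightarrow> nat \<Rightarrow> 'k" where
  "unit_coord n i = (\<lambda>m j. if m = n \<and> j = i then 1 else 0)"

definition coord :: "nat \<Rightarrow> nat \<Rightarrow> (nat \<Rightarrow> nat \<Rightarrow> 'k) \<Rightarrow> 'k" where
  "coord n i x = (if x \<in> carrier W then x n i else 0)"

lemma block_system_W: "block_system W unit_coord coord"
proof -
  interpret normed_vspace W by (rule normed_vspace_W)
  show ?thesis
  proof
    fix n i :: nat assume i: "i \<le> n"
    have single: "triangular (unit_coord n i)" "\<And>k. k \<noteq> n \<Longrightarrow> unit_coord n i k = 0"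
      "block_norm n (unit_coord n i n) \<le> 1"
      using i by (auto simp: unit_coord_def triangular_def fun_eq_iff block_norm_le_iff)
    show "unit_coord n i \<in> carrier W"
      by (rule W_single_block(1)[OF single])
    show "nrm W (unit_coord n i) \<le> 1"
      by (rule W_single_block(2)[OF single])
    show "norm (coord n i x) \<le> nrm W x" if "x \<in> carrier W" for x
      using norm_coordinate_le_nrm_W[OF that i] that by (simp add: coord_def)
    then show "coord n i \<in> operators W scalar_space"
      by (intro operatorsI[where C = 1]) (auto simp: coord_def add_mem scl_mem[unfolded scl_W] scl_W)
  next
    fix n i m j :: nat assume "i \<le> n" "j \<le> m"
    then have "triangular (unit_coord m j)" "\<And>k. k \<noteq> m \<Longrightarrow> unit_coord m j k = 0"
      "block_norm m (unit_coord m j m) \<le> 1"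
      by (auto simp: unit_coord_def triangular_def fun_eq_iff block_norm_le_iff)
    then have "unit_coord m j \<in> carrier W"
      by (rule W_single_block)
    then show "coord n i (unit_coord m j) = (if n = m \<and> i = j then 1 else 0)"
      by (simp add: coord_def unit_coord_def)
  qed
qed

lemma initial_proj_W:
  assumes x: "x \<in> carrier W"
  shows "block_system.initial_proj W unit_coord coord N x = (\<lambda>n. if n < N then x n else 0)"
proof (intro ext)
  fix m j
  interpret block_system W unit_coord coord by (rule block_system_W)
  have "initial_proj N x m j = (\<Sum>n<N. \<Sum>i\<le>n. x n i * (if m = n \<and> j = i then 1 else 0))"
    using x by (simp add: initial_proj_def sum_fun_apply scl_W coord_def unit_coord_def)
  also have "\<dots> = (\<Sum>n<N. \<Sum>i\<le>n. if n = m then (if i = j then x n i else 0) else 0)"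
    by (intro sum.cong refl) simp
  also have "\<dots> = (\<Sum>n<N. if n = m then (\<Sum>i\<le>n. if i = j then x n i else 0) else 0)"
    by (intro sum.cong refl) simp
  also have "\<dots> = (if m < N then (if j \<le> m then x m j else 0) else 0)"
    by simp
  also have "\<dots> = (if m < N then x m else 0) j"
    using x by (auto simp: mem_W triangular_def)
  finally show "initial_proj N x m j = (if m < N then x m else 0) j" .
qed

lemma nrm_W_disjoint:
  assumes x: "x \<in> carrier W" and y: "y \<in> carrier W" and disj: "\<And>n. x n = 0 \<or> y n = 0"
  shows "nrm W (x + y) powr p = nrm W x powr p + nrm W y powr p"
proof -
  have "block_norm n ((x + y) n) powr p = block_norm n (x n) powr p + block_norm n (y n) powr p" for n
    using disj[of n] p by (auto simp: block_norm_zero)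
  moreover have "summable (\<lambda>n. block_norm n (x n) powr p)" "summable (\<lambda>n. block_norm n (y n) powr p)"
    using x y by (simp_all add: mem_W)
  ultimately show ?thesis
    by (simp add: nrm_W_powr x y W_triangle suminf_add)
qed

lemma cut_W:
  assumes x: "x \<in> carrier W"
  shows "(\<lambda>n. if n \<in> A then x n else 0) \<in> carrier W"
    and "nrm W (\<lambda>n. if n \<in> A then x n else 0) \<le> nrm W x"
proof -
  have "triangular (\<lambda>n. if n \<in> A then x n else 0)"
    using x by (simp add: mem_W triangular_def)
  then show "(\<lambda>n. if n \<in> A then x n else 0) \<in> carrier W" "nrm W (\<lambda>n. if n \<in> A then x n else 0) \<le> nrm W x"
    using W_dominated[OF x, of "\<lambda>n. if n \<in> A then x n else 0" "\<lambda>n. n" A 1] by simp_all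
qed

lemma block_basis_W: "block_basis W unit_coord coord"
proof -
  interpret block_system W unit_coord coord by (rule block_system_W)
  interpret complete_normed_vspace W by (rule complete_W)
  show ?thesis
  proof
    fix x assume x: "x \<in> carrier W"
    let ?f = "\<lambda>n. block_norm n (x n) powr p"
    have summ: "summable ?f" using x by (simp add: mem_W)
    have "nrm W (initial_proj N x - x) = (nrm W x powr p - (\<Sum>n<N. ?f n)) powr (1 / p)" for N
    proof -
      define y where "y = (\<lambda>n. if n \<in> {..<N} then x n else 0)"
      have y: "y \<in> carrier W" unfolding y_def by (rule cut_W(1)[OF x])
      have d: "x - y \<in> carrier W" by (rule diff_mem[OF x y])
      have "nrm W (y + (x - y)) powr p = nrm W y powr p + nrm W (x - y) powr p"
        by (rule nrm_W_disjoint[OF y d]) (simp add: y_def)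
      moreover have "nrm W y powr p = (\<Sum>n<N. ?f n)"
        unfolding nrm_W_powr[OF y]
        by (subst suminf_finite[of "{..<N}"]) (use p in \<open>auto simp: y_def block_norm_zero\<close>)
      ultimately have "nrm W x powr p - (\<Sum>n<N. ?f n) = nrm W (x - y) powr p"
        by simp
      moreover have "initial_proj N x = y"
        by (simp add: initial_proj_W[OF x] y_def)
      ultimately show ?thesis
        by (simp add: powr_p_root nrm_W_nonneg nrm_minus_commute[OF y x])
    qed
    moreover have "(\<lambda>N. (nrm W x powr p - (\<Sum>n<N. ?f n)) powr (1 / p)) \<longlonglongrightarrow> 0"
    proof (rule tendsto_zero_powrI)
      have "(\<lambda>N. nrm W x powr p - (\<Sum>n<N. ?f n)) \<longlonglongrightarrow> nrm W x powr p - nrm W x powr p"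
        unfolding nrm_W_powr[OF x] by (intro tendsto_diff tendsto_const summable_LIMSEQ summ)
      then show "(\<lambda>N. nrm W x powr p - (\<Sum>n<N. ?f n)) \<longlonglongrightarrow> 0" by simp
      show "\<forall>\<^sub>F N in sequentially. 0 \<le> nrm W x powr p - (\<Sum>n<N. ?f n)"
        using finite_sum_le_nrm_W[OF x] by simp
    qed (use p in auto)
    ultimately show "(\<lambda>N. nrm W (initial_proj N x - x)) \<longlonglongrightarrow> 0"
      by simp
  next
    fix a :: "nat \<Rightarrow> nat \<Rightarrow> 'k" and C assume a: "\<And>n i. i \<le> n \<Longrightarrow> norm (a n i) \<le> C"
    have C: "0 \<le> C"
      by (rule order_trans[OF norm_ge_zero a[of 0 0]]) simp
    define D where "D x = (if x \<in> carrier W then (\<lambda>n i. a n i * x n i) else 0)" for x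
    have D: "D x \<in> carrier W \<and> nrm W (D x) \<le> C * nrm W x" if x: "x \<in> carrier W" for x
    proof -
      have "triangular (D x)"
        using x by (simp add: mem_W triangular_def D_def)
      moreover have "block_norm n (D x n) \<le> C * block_norm n (x n)" for n
        using x by (simp add: D_def block_norm_mult_le a)
      ultimately show ?thesis
        using W_dominated[OF x, of "D x" "\<lambda>n. n" UNIV C] C by simp
    qed
    have "D \<in> operators W W"
      by (rule operatorsI[where C = C])
        (use D add_mem scl_mem in \<open>auto simp: D_def fun_eq_iff scl_W algebra_simps\<close>)
    moreover have "coord n i (D x) = a n i * coord n i x" if "x \<in> carrier W" for n i x
      using D[OF that] that by (simp add: coord_def) (simp add: D_def)
    ultimately show "\<exists>D\<in>operators W W. \<forall>x\<in>carrier W. \<forall>n. \<forall>i\<le>n. coord n i (D x) = a n i * coord n i x"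
      by blast
  next
    fix m :: "nat \<Rightarrow> nat" and b
    assume m: "strict_mono m" and b: "\<And>n. inj_on (b n) {..n}" and b_le: "\<And>n i. i \<le> n \<Longrightarrow> b n i \<le> m n"
    have inj: "inj m" using m by (rule strict_mono_imp_inj_on)
    define Q where "Q x = (\<lambda>n i. if x \<in> carrier W \<and> i \<le> n then x (m n) (b n i) else 0)"
      for x :: "nat \<Rightarrow> nat \<Rightarrow> 'k"
    have Q: "Q x \<in> carrier W \<and> nrm W (Q x) \<le> nrm W x" if x: "x \<in> carrier W" for x
    proof -
      have "triangular (Q x)"
        by (simp add: triangular_def Q_def)
      moreover have "block_norm n (Q x n) \<le> block_norm (m n) (x (m n))" for n
        by (auto simp: Q_def block_norm_le_iff b_le block_norm_nonneg intro!: norm_le_block_norm)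
      ultimately show ?thesis
        using W_dominated[OF x, of "Q x" m UNIV 1] inj by simp
    qed
    have Q_op: "Q \<in> operators W W"
      by (rule operatorsI[where C = 1])
        (use Q add_mem scl_mem in \<open>auto simp: Q_def fun_eq_iff scl_W\<close>)
    (* R puts the coordinate (n, i) at (m n, b n i) and fills the remaining places with 0. *)
    define R where "R x = (\<lambda>k j. if x \<in> carrier W \<and> k \<in> range m \<and> j \<in> b (inv_into UNIV m k) ` {..inv_into UNIV m k}
        then x (inv_into UNIV m k) (inv_into {..inv_into UNIV m k} (b (inv_into UNIV m k)) j) else 0)" for x :: "nat \<Rightarrow> nat \<Rightarrow> 'k"
    have inv_m: "inv_into UNIV m (m n) = n" for n
      by (rule inv_f_f[OF inj])
    have R: "R x \<in> carrier W \<and> nrm W (R x) \<le> nrm W x" if x: "x \<in> carrier W" for x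
    proof -
      have "triangular (R x)"
        unfolding triangular_def
      proof (intro allI impI)
        fix k j :: nat assume "k < j"
        then have "\<not> (k \<in> range m \<and> j \<in> b (inv_into UNIV m k) ` {..inv_into UNIV m k})"
          using b_le by (auto simp: inv_m) (meson leD)
        then show "R x k j = 0" by (auto simp: R_def)
      qed
      moreover have "block_norm k (R x k) \<le> block_norm (inv_into UNIV m k) (x (inv_into UNIV m k))" for k
      proof -
        have "inv_into {..inv_into UNIV m k} (b (inv_into UNIV m k)) j \<le> inv_into UNIV m k" if "j \<in> b (inv_into UNIV m k) ` {..inv_into UNIV m k}" for j
          using inv_into_into[OF that] by simp
        then show ?thesis
          by (auto simp: R_def block_norm_le_iff block_norm_nonneg intro!: norm_le_block_norm)
      qed
      moreover have "R x k = 0" if "k \<notin> range m" for k :: nat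
        using that by (simp add: R_def fun_eq_iff)
      ultimately show ?thesis
        using W_dominated[OF x, of "R x" "inv_into UNIV m" "range m" 1] inj_on_inv_into[of "range m" m UNIV] by simp
    qed
    have R_op: "R \<in> operators W W"
      by (rule operatorsI[where C = 1])
        (use R add_mem scl_mem in \<open>auto simp: R_def fun_eq_iff scl_W\<close>)
    have "R (unit_coord n i) = unit_coord (m n) (b n i)" if i: "i \<le> n" for n i
    proof (intro ext)
      fix k j
      show "R (unit_coord n i) k j = unit_coord (m n) (b n i) k j"
      proof (cases "k \<in> range m")
        case True
        then obtain l where k: "k = m l" by blast
        have ml: "m l = m n \<longleftrightarrow> l = n"
          using inj by (simp add: inj_eq)
        show ?thesis
        proof (cases "j \<in> b l ` {..l}")
          case True
          then obtain h where h: "h \<le> l" "j = b l h" by auto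
          have "R (unit_coord n i) k j = unit_coord n i l h"
            using e_mem[OF i] True b[of l] h by (simp add: R_def k inv_m inv_into_f_f)
          moreover have "b l h = b l i \<longleftrightarrow> h = i" if "l = n"
            using b[of l] that h i by (auto simp: inj_on_def)
          ultimately show ?thesis
            by (auto simp: unit_coord_def k ml h(2))
        next
          case False
          then have "\<not> (l = n \<and> j = b n i)" using i by auto
          with False show ?thesis
            by (auto simp: R_def k inv_m unit_coord_def ml)
        qed
      next
        case False
        then show ?thesis by (auto simp: R_def unit_coord_def)
      qed
    qed
    moreover have "coord n i (Q x) = coord (m n) (b n i) x" if "x \<in> carrier W" "i \<le> n" for n i x
      using Q[OF that(1)] that by (simp add: coord_def) (simp add: Q_def)
    ultimately show "\<exists>R\<in>operators W W. \<exists>Q\<in>operators W W.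
        (\<forall>n. \<forall>i\<le>n. R (unit_coord n i) = unit_coord (m n) (b n i)) \<and>
        (\<forall>x\<in>carrier W. \<forall>n. \<forall>i\<le>n. coord n i (Q x) = coord (m n) (b n i) x)"
      using R_op Q_op by blast
  qed
qed

text \<open>
  For disjointly supported vectors of norms \<open>a\<close> and \<open>b\<close> the norm of the sum is \<open>(a\<^sup>p + b\<^sup>p)\<^bsup>1/p\<^esup>\<close>.  This
  is at most \<open>2\<^bsup>1/p\<^esup>\<close> if \<open>a, b \<le> 1\<close>, and at least \<open>2\<^bsup>1/p - 1\<^esup> (a + b)\<close> by convexity; the
  two constants \<open>2\<^bsup>1/p\<^esup>\<close> and \<open>2\<^bsup>1 - 1/p\<^esup>\<close> are below \<open>2\<close> because \<open>1 < p < \<infinity>\<close>.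
\<close>
lemma strict_block_basis_W:
  "strict_block_basis W unit_coord coord (max (2 powr (1 / p)) (2 powr (1 - 1 / p)))"
proof -
  interpret block_basis W unit_coord coord by (rule block_basis_W)
  let ?\<theta> = "max (2 powr (1 / p)) (2 powr (1 - 1 / p)) :: real"
  have tail: "x - initial_proj N x = (\<lambda>n. if n \<in> {N..} then x n else 0)" if "x \<in> carrier W" for x N
    by (auto simp: initial_proj_W[OF that] fun_eq_iff)
  show ?thesis
  proof
    show "0 < ?\<theta>" by (simp add: less_max_iff_disj)
    have "2 powr (1 / p) < 2 powr (1::real)"
      by (rule powr_less_mono) (use p in auto)
    moreover have "2 powr (1 - 1 / p) < 2 powr (1::real)"
      by (rule powr_less_mono) (use p in auto)
    ultimately show "?\<theta> < 2" by simp
  next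
    fix x N assume x: "x \<in> carrier W"
    show "nrm W (initial_proj N x) \<le> nrm W x"
      using cut_W(2)[OF x, of "{..<N}"] by (simp add: initial_proj_W[OF x])
    show "nrm W (x - initial_proj N x) \<le> nrm W x"
      using cut_W(2)[OF x, of "{N..}"] by (simp only: tail[OF x])
    let ?a = "nrm W (initial_proj N x)" and ?b = "nrm W (x - initial_proj N x)"
    have "nrm W (initial_proj N x + (x - initial_proj N x)) powr p = ?a powr p + ?b powr p"
      by (rule nrm_W_disjoint[OF initial_proj_mem diff_mem[OF x initial_proj_mem]])
        (simp add: initial_proj_W[OF x])
    then have sum: "?a powr p + ?b powr p = nrm W x powr p" by simp
    have "((?a + ?b) / 2) powr p \<le> (?a powr p + ?b powr p) / 2"
      using powr_convex_combination[of p "1/2" ?a ?b] p by (simp add: nrm_W_nonneg add_divide_distrib)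
    then have "((?a + ?b) / 2) powr p \<le> nrm W x powr p / 2"
      by (simp only: sum)
    also have "\<dots> = ((1/2) powr (1 / p) * nrm W x) powr p"
      using p by (simp add: powr_mult nrm_W_nonneg powr_powr)
    finally have "(?a + ?b) / 2 \<le> (1/2) powr (1 / p) * nrm W x"
      by (rule le_of_powr_p_le[rotated 2]) (simp_all add: nrm_W_nonneg add_nonneg_nonneg)
    then have "?a + ?b \<le> 2 * (1/2) powr (1 / p) * nrm W x"
      by simp
    also have "2 * (1/2) powr (1 / p) = 2 powr (1 - 1 / p)"
      by (simp add: powr_diff powr_divide)
    also have "2 powr (1 - 1 / p) * nrm W x \<le> ?\<theta> * nrm W x"
      by (intro mult_right_mono nrm_W_nonneg) simp
    finally show "?a + ?b \<le> ?\<theta> * nrm W x" .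
  next
    fix x y N assume x: "x \<in> carrier W" and y: "y \<in> carrier W" and le: "nrm W x \<le> 1" "nrm W y \<le> 1"
      and P: "initial_proj N x = x" "initial_proj N y = 0"
    have "x n = 0 \<or> y n = 0" for n
      using fun_cong[OF P(1), of n] fun_cong[OF P(2), of n]
      by (cases "n < N") (simp_all add: initial_proj_W x y)
    then have "nrm W (x + y) powr p = nrm W x powr p + nrm W y powr p"
      by (rule nrm_W_disjoint[OF x y])
    also have "\<dots> \<le> 1 powr p + 1 powr p"
      by (intro add_mono powr_p_mono nrm_W_nonneg le)
    also have "\<dots> = (2 powr (1 / p)) powr p"
      using p by (simp add: powr_powr)
    finally have "nrm W (x + y) \<le> 2 powr (1 / p)"
      by (rule le_of_powr_p_le[rotated 2]) (simp_all add: nrm_W_nonneg)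
    then show "nrm W (x + y) \<le> ?\<theta>" by simp
  next
    fix n and c :: "nat \<Rightarrow> 'k" assume c: "\<And>i. i \<le> n \<Longrightarrow> norm (c i) \<le> 1"
    let ?x = "\<Sum>i\<le>n. scl W (c i) (unit_coord n i)"
    have eq: "?x k j = (if k = n \<and> j \<le> n then c j else 0)" for k j
    proof -
      have "?x k j = (\<Sum>i\<le>n. if i = j then (if k = n then c i else 0) else 0)"
        unfolding sum_fun_apply by (intro sum.cong refl) (simp add: scl_W unit_coord_def)
      then show ?thesis by simp
    qed
    show "nrm W ?x \<le> 1"
    proof (rule W_single_block(2))
      show "triangular ?x" by (simp add: triangular_def eq)
      show "?x k = 0" if "k \<noteq> n" for k using that by (simp add: fun_eq_iff eq)
      show "block_norm n (?x n) \<le> 1" using c by (simp add: block_norm_le_iff eq)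
    qed
  qed
qed

theorem unique_maximal_ideal_W: "unique_maximal_ideal (M_set W) (operator_algebra W)"
  by (rule sparse_block_basis.unique_maximal_ideal[OF strict_block_basis.sparse[OF strict_block_basis_W]])

theorem unique_maximal_ideal_dual_W:
  "unique_maximal_ideal (M_set (dual_space W)) (operator_algebra (dual_space W))"
  by (rule sparse_block_basis.unique_maximal_ideal[OF sparse_block_basis_dual[OF strict_block_basis_W]])

end

theorem theorem1p1:
  fixes p :: real
  assumes "1 < p"
  shows
    "unique_maximal_ideal (M_set (W_space TYPE(real) p))
       (operator_algebra (W_space TYPE(real) p)) \<and>
     unique_maximal_ideal (M_set (dual_space (W_space TYPE(real) p)))
       (operator_algebra (dual_space (W_space TYPE(real) p))) \<and>
     unique_maximal_ideal (M_set (W_space TYPE(complex) p))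
       (operator_algebra (W_space TYPE(complex) p)) \<and>
     unique_maximal_ideal (M_set (dual_space (W_space TYPE(complex) p)))
       (operator_algebra (dual_space (W_space TYPE(complex) p)))"
  using assms by (intro conjI unique_maximal_ideal_W unique_maximal_ideal_dual_W)

end
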